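(* Let $d\ge 3$ and let $C\subset\mathbb{R}^d$ be a polytope (convex or not). Then $C$ is not cover-decomposable in $\mathbb{R}^d$: for every $m$ there is an $m$-fold covering of $\mathbb{R}^d$ by translates of $C$ that cannot be decomposed into two coverings of $\mathbb{R}^d$.
   Context: A collection of translates of $C$ (repetitions allowed) is an $m$-fold covering of $\mathbb{R}^d$ if every point of $\mathbb{R}^d$ lies in at least $m$ members; it can be decomposed into two coverings if it can be partitioned into two subcollections, each covering all of $\mathbb{R}^d$. $C$ is cover-decomposable if some $m$ exists such that every $m$-fold covering of $\mathbb{R}^d$ by translates of $C$ can be so decomposed. Polytopes are bounded full-dimensional polyhedral sets. *)

theory Defs
  imports "HOL-Analysis.Analysis"
begin

definition polyhedral_set :: "'a::euclidean_space set \<Rightarrow> bool" where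
  "polyhedral_set S \<longleftrightarrow> (\<exists>F. finite F \<and> (\<forall>P\<in>F. polyhedron P) \<and> S = \<Union>F)"

(* The library's polytope is a convex hull of finitely many points; here neither convexity nor
   connectedness is required.  The condition P = closure (interior P) says that P is
   full-dimensional at each of its points (no lower-dimensional parts attached).
   The closed solid and its interior both count as polytopes. *)
definition solid_polytope :: "'a::euclidean_space set \<Rightarrow> bool" where
  "solid_polytope C \<longleftrightarrow>
     bounded C \<and> C \<noteq> {} \<and>
     (\<exists>P. polyhedral_set P \<and> P = closure (interior P) \<and> (C = P \<or> C = interior P))"

(* A collection of translates with repetitions is a family of translation vectors t i, i \<in> I;
   its members are the sets t i + C. *)
definition covering :: "'a::euclidean_space set \<Rightarrow> ('i \<Rightarrow> 'a) \<Rightarrow> 'i set \<Rightarrow> bool" where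
  "covering C t I \<longleftrightarrow> (\<Union>i\<in>I. (+) (t i) ` C) = UNIV"

definition fold_covering ::
    "nat \<Rightarrow> 'a::euclidean_space set \<Rightarrow> ('i \<Rightarrow> 'a) \<Rightarrow> 'i set \<Rightarrow> bool" where
  "fold_covering m C t I \<longleftrightarrow>
     (\<forall>p. \<exists>J\<subseteq>I. finite J \<and> card J = m \<and> (\<forall>i\<in>J. p \<in> (+) (t i) ` C))"

definition decomposes_into_two_coverings ::
    "'a::euclidean_space set \<Rightarrow> ('i \<Rightarrow> 'a) \<Rightarrow> 'i set \<Rightarrow> bool" where
  "decomposes_into_two_coverings C t I \<longleftrightarrow>
     (\<exists>A B. A \<union> B = I \<and> A \<inter> B = {} \<and> covering C t A \<and> covering C t B)"

(* HOL cannot quantify over index types inside a formula.  Real indices give every family in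
   which each translate is repeated at most continuum many times.  This is no restriction: a
   translate occurring at least twice can be put into both parts, so larger multiplicities do
   not affect decomposability (nor, if kept above m, the property of being an m-fold
   covering). *)
definition cover_decomposable :: "'a::euclidean_space set \<Rightarrow> bool" where
  "cover_decomposable C \<longleftrightarrow>
     (\<exists>m. \<forall>(t :: real \<Rightarrow> 'a) I.
        fold_covering m C t I \<longrightarrow> decomposes_into_two_coverings C t I)"

end

theory Submission imports Defs
begin

text \<open>
  A covering is built from finitely many points, each lying in at least \<open>m\<close> members of a finite family
  of translates, such that every 2-colouring of this family leaves one of the points in a single
  colour; further translates that avoid these points cover everything else.

  The finite configuration lives near two vertices \<open>c\<^sub>1\<close>, \<open>c\<^sub>2\<close> of the polytope, where only the tangent
  cones \<open>K\<^sub>1\<close>, \<open>K\<^sub>2\<close> matter. A recursive tree construction works as soon as there are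
  \<open>X \<in> int K\<^sub>1 - K\<^sub>2\<close> and \<open>Y \<in> int K\<^sub>2 - K\<^sub>1\<close> such that neither \<open>X - Y\<close> nor \<open>Y - X\<close> lies in \<open>K\<^sub>1 \<union> K\<^sub>2\<close>.
  In dimension at least 3 it is enough that the cones are not nested and are both supported by some
  \<open>a \<noteq> 0\<close> whose orthogonal complement meets them in a single line only. Let \<open>a\<close> run along a generic
  line. Every position supports the cone of some vertex; if cones with a common supporting
  position were always nested, the sets of positions supporting a given cone would be a finite
  laminar family of closed sets covering the line, so by connectedness one cone would be supported
  at all positions, which is impossible for a cone with interior points.

  All the chosen points lie on two parallel lines, hence in a hyperplane, which a small
  perturbation makes generic. A point outside the configuration is then covered by a translate that
  touches this hyperplane only near that point, at a unique extreme vertex.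
\<close>

section \<open>From finite configurations to indecomposable coverings\<close>

lemma translate_mem_iff:
  fixes p s :: "'a::euclidean_space"
  shows "p \<in> (+) s ` C \<longleftrightarrow> p - s \<in> C"
proof
  assume "p - s \<in> C"
  then show "p \<in> (+) s ` C" by (rule rev_image_eqI) simp
qed auto

text \<open>Each element of \<open>S\<close> gets exactly one index, since a repeated translate
  could go into both parts and spoil the configuration. Each \<open>e n\<close> gets infinitely
  many, so one \<open>e n\<close> through a point covers it \<open>m\<close> times for every
  \<open>m\<close>.\<close>

lemma indexed_translates:
  fixes S :: "'a set" and e :: "nat \<Rightarrow> 'a"
  assumes "finite S"
  obtains t :: "real \<Rightarrow> 'a" and I J where
    "I \<inter> J = {}" "bij_betw t I S" "t ` J \<subseteq> range e" "\<And>n. infinite {i\<in>J. t i = e n}"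
proof -
  obtain h where h: "bij_betw h {..<card S} S"
    using bij_betw_from_nat_into_finite[OF assms] by blast
  define N where "N = card S"
  define t where "t r = (let n = nat \<lfloor>r\<rfloor> in
      if n < N then h n else e (snd (prod_decode (n - N))))" for r :: real
  define I where "I = real ` {..<N}"
  define J where "J = real ` {N..}"
  have "bij_betw real {..<N} I"
    unfolding I_def by (auto intro: inj_on_imp_bij_betw simp: inj_on_def)
  moreover have "bij_betw (t \<circ> real) {..<N} S"
    using h unfolding N_def by (rule bij_betw_cong[THEN iffD1, rotated]) (auto simp: t_def N_def)
  ultimately have "bij_betw t I S"
    using bij_betw_comp_iff by blast
  moreover have "I \<inter> J = {}" by (auto simp: I_def J_def)
  moreover have "t ` J \<subseteq> range e" by (auto simp: J_def t_def)
  moreover have "infinite {i\<in>J. t i = e n}" for n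
  proof -
    have "inj (\<lambda>k. real (N + prod_encode (k, n)))"
      by (auto simp: inj_on_def prod_encode_eq)
    then have "infinite (range (\<lambda>k. real (N + prod_encode (k, n))))"
      using finite_imageD by blast
    moreover have "range (\<lambda>k. real (N + prod_encode (k, n))) \<subseteq> {i\<in>J. t i = e n}"
    proof safe
      fix k
      show "real (N + prod_encode (k, n)) \<in> J" unfolding J_def by (rule imageI) simp
      have "nat \<lfloor>real (N + prod_encode (k, n))\<rfloor> = N + prod_encode (k, n)"
        by (metis floor_of_nat nat_int)
      then show "t (real (N + prod_encode (k, n))) = e n" by (simp add: t_def Let_def)
    qed
    ultimately show ?thesis using finite_subset by blast
  qed
  ultimately show ?thesis using that by blast
qed

text \<open>The further translates all miss \<open>F\<close>, so at a point of \<open>F\<close> both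
  parts must be served by the finite family, which some monochromatic edge prevents. The last
  condition speaks of \<open>interior C\<close> so that Lindelof's theorem leaves countably many
  further translates.\<close>

lemma not_cover_decomposable_if_configurations:
  fixes C :: "'a::euclidean_space set"
  assumes "\<And>m. \<exists>S F. finite S \<and> finite F \<and>
      (\<forall>p\<in>F. m \<le> card {s\<in>S. p - s \<in> C}) \<and>
      (\<forall>R. \<exists>p\<in>F. {s\<in>S. p - s \<in> C} \<subseteq> R \<or> {s\<in>S. p - s \<in> C} \<inter> R = {}) \<and>
      (\<forall>x. x \<notin> F \<longrightarrow> (\<exists>t. x - t \<in> interior C \<and> (\<forall>p\<in>F. p - t \<notin> C)))"
  shows "\<not> cover_decomposable C"
  unfolding cover_decomposable_def
proof clarify
  fix m
  assume dec: "\<forall>(t :: real \<Rightarrow> 'a) I. fold_covering m C t I \<longrightarrow> decomposes_into_two_coverings C t I"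
  obtain S F where S: "finite S" "finite F" and
    deg: "\<forall>p\<in>F. m \<le> card {s\<in>S. p - s \<in> C}" and
    col: "\<And>R. \<exists>p\<in>F. {s\<in>S. p - s \<in> C} \<subseteq> R \<or> {s\<in>S. p - s \<in> C} \<inter> R = {}" and
    ext: "\<And>x. x \<notin> F \<Longrightarrow> \<exists>t. x - t \<in> interior C \<and> (\<forall>p\<in>F. p - t \<notin> C)"
    using assms[of m] by blast
  define T where "T = {t. \<forall>p\<in>F. p - t \<notin> C}"
  obtain D where D: "D \<subseteq> (\<lambda>t. (+) t ` interior C) ` T" "countable D"
      "\<Union>D = \<Union>((\<lambda>t. (+) t ` interior C) ` T)"
    by (rule Lindelof[of "(\<lambda>t. (+) t ` interior C) ` T"]) (auto intro: open_translation)
  obtain T0 where T0: "countable T0" "T0 \<subseteq> T" "D = (\<lambda>t. (+) t ` interior C) ` T0"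
    using D(1,2) countable_image_eq_inj countable_subset_image by metis
  have covT0: "\<exists>t\<in>T0. x - t \<in> C" if "x \<notin> F" for x
  proof -
    have "x \<in> \<Union>((\<lambda>t. (+) t ` interior C) ` T)"
      using ext[OF that] by (auto simp: T_def translate_mem_iff)
    then obtain t where "t \<in> T0" "x \<in> (+) t ` interior C"
      unfolding D(3)[symmetric] T0(3) by blast
    then show ?thesis using interior_subset by (auto simp: translate_mem_iff)
  qed
  have "UNIV \<noteq> F" using S(2) finite_imp_bounded not_bounded_UNIV by metis
  then have "T0 \<noteq> {}" using covT0 by blast
  then obtain e where e: "T0 = range (e :: nat \<Rightarrow> 'a)"
    using T0(1) range_from_nat_into by metis
  obtain t :: "real \<Rightarrow> 'a" and I J where t: "I \<inter> J = {}" "bij_betw t I S" "t ` J \<subseteq> T0"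
      "\<And>n. infinite {i\<in>J. t i = e n}"
    using indexed_translates[OF S(1)] e by metis
  have tI: "t ` I = S" "inj_on t I" using t(2) by (auto simp: bij_betw_def)
  have miss: "p - t i \<notin> C" if "i \<in> J" "p \<in> F" for i p
    using that t(3) T0(2) by (auto simp: T_def)
  have "fold_covering m C t (I \<union> J)"
    unfolding fold_covering_def translate_mem_iff
  proof
    fix p
    show "\<exists>J'\<subseteq>I \<union> J. finite J' \<and> card J' = m \<and> (\<forall>i\<in>J'. p - t i \<in> C)"
    proof (cases "p \<in> F")
      case True
      have "card {s\<in>S. p - s \<in> C} = card (t ` {i\<in>I. p - t i \<in> C})"
        using tI(1) by (intro arg_cong[where f = card]) auto
      also have "\<dots> = card {i\<in>I. p - t i \<in> C}"
        by (intro card_image inj_on_subset[OF tI(2)]) blast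
      finally have "m \<le> card {i\<in>I. p - t i \<in> C}" using bspec[OF deg True] by simp
      from obtain_subset_with_card_n[OF this]
      obtain J' where "J' \<subseteq> {i\<in>I. p - t i \<in> C}" "card J' = m" "finite J'" by blast
      then show ?thesis by (intro exI[of _ J']) auto
    next
      case False
      then obtain n where n: "p - e n \<in> C" using covT0 e by blast
      obtain J' where "J' \<subseteq> {i\<in>J. t i = e n}" "finite J'" "card J' = m"
        using infinite_arbitrarily_large[OF t(4)] by blast
      then show ?thesis using n by (intro exI[of _ J']) auto
    qed
  qed
  from dec[rule_format, OF this]
  obtain A B where AB: "A \<union> B = I \<union> J" "A \<inter> B = {}" "covering C t A" "covering C t B"
    unfolding decomposes_into_two_coverings_def by blast
  have covA: "\<exists>i\<in>A. p - t i \<in> C" and covB: "\<exists>i\<in>B. p - t i \<in> C" for p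
    using eqset_imp_iff[OF AB(3)[unfolded covering_def], of p]
      eqset_imp_iff[OF AB(4)[unfolded covering_def], of p] by (auto simp: translate_mem_iff)
  \<comment> \<open>The colour class tested consists of the translates in \<open>S\<close> whose
    index lies in \<open>A\<close>.\<close>
  obtain p where p: "p \<in> F" "{s\<in>S. p - s \<in> C} \<subseteq> t ` (A \<inter> I) \<or> {s\<in>S. p - s \<in> C} \<inter> t ` (A \<inter> I) = {}"
    using col by blast
  obtain a b where ab: "a \<in> A" "p - t a \<in> C" "b \<in> B" "p - t b \<in> C" using covA covB by meson
  then have "a \<in> I" "b \<in> I" using miss p(1) AB(1) by blast+
  moreover from this have "t b \<notin> t ` (A \<inter> I)"
    using tI(2) AB(2) ab(3) by (auto dest!: inj_onD)
  ultimately show False using p(2) ab tI(1) by blast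
qed

section \<open>The tree construction\<close>

text \<open>The vertices of the hypergraph are the points of \<open>S\<close>, standing for translation vectors; a point
  \<open>p \<in> P\<close> (respectively \<open>p \<in> Q\<close>) is the edge of all \<open>s\<close> with \<open>p \<in> s + K\<close> (respectively \<open>p \<in> s + L\<close>). In
  every colouring some edge of \<open>P\<close> lies inside the colour class \<open>R\<close> or some edge of \<open>Q\<close> avoids it.\<close>

definition tree_conf ::
    "'a::euclidean_space set \<Rightarrow> 'a set \<Rightarrow> 'a \<Rightarrow> nat \<Rightarrow> nat \<Rightarrow> 'a set \<Rightarrow> 'a set \<Rightarrow> 'a set \<Rightarrow> bool" where
  "tree_conf K L z k l S P Q \<longleftrightarrow>
     finite S \<and> finite P \<and> finite Q \<and> P \<union> Q \<subseteq> range (\<lambda>r. r *\<^sub>R z) \<and>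
     (\<forall>p\<in>P. \<forall>s\<in>S. p - s \<in> K \<longrightarrow> p - s \<in> interior K) \<and>
     (\<forall>q\<in>Q. \<forall>s\<in>S. q - s \<in> L \<longrightarrow> q - s \<in> interior L) \<and>
     (\<forall>p\<in>P. k \<le> card {s\<in>S. p - s \<in> K}) \<and>
     (\<forall>q\<in>Q. l \<le> card {s\<in>S. q - s \<in> L}) \<and>
     (\<forall>R. (\<exists>p\<in>P. {s\<in>S. p - s \<in> K} \<subseteq> R) \<or> (\<exists>q\<in>Q. {s\<in>S. q - s \<in> L} \<inter> R = {}))"

lemma conic_scaleR_mem_iff:
  assumes "conic K" "0 < \<sigma>"
  shows "\<sigma> *\<^sub>R x \<in> K \<longleftrightarrow> x \<in> K"
proof
  assume "\<sigma> *\<^sub>R x \<in> K"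
  then have "(1/\<sigma>) *\<^sub>R (\<sigma> *\<^sub>R x) \<in> K" using assms unfolding conic_def by (metis less_imp_le zero_le_divide_1_iff)
  then show "x \<in> K" using assms(2) by simp
qed (use assms in \<open>auto simp: conic_def\<close>)

lemma conic_scaleR_mem_interior_iff:
  fixes K :: "'a::euclidean_space set"
  assumes "conic K" "0 < \<sigma>"
  shows "\<sigma> *\<^sub>R x \<in> interior K \<longleftrightarrow> x \<in> interior K"
proof -
  have "(*\<^sub>R) \<sigma> ` K = K"
  proof (intro equalityI subsetI)
    fix x assume "x \<in> K"
    then have "(1/\<sigma>) *\<^sub>R x \<in> K" "x = \<sigma> *\<^sub>R ((1/\<sigma>) *\<^sub>R x)"
      using conic_scaleR_mem_iff[of K "1/\<sigma>"] assms by auto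
    then show "x \<in> (*\<^sub>R) \<sigma> ` K" by (rule rev_image_eqI)
  qed (use assms in \<open>auto simp: conic_def\<close>)
  moreover have "interior ((*\<^sub>R) \<sigma> ` K) = (*\<^sub>R) \<sigma> ` interior K"
    using assms(2) by (intro interior_injective_linear_image) (auto simp: inj_on_def linear_scale_self)
  ultimately show ?thesis
    using assms(2) by (metis (no_types, lifting) image_iff scaleR_cancel_left less_numeral_extra(3))
qed

text \<open>Edges depend only on differences up to positive scaling, because the cones are conic.
  The shift goes along \<open>z\<close> so that the edge points stay on the line spanned by
  \<open>z\<close>.\<close>

lemma tree_conf_affine_image:
  assumes conf: "tree_conf K L z k l S P Q" and K: "conic K" and L: "conic L"
    and \<sigma>: "0 < \<sigma>" and f: "f = (\<lambda>x. \<mu> *\<^sub>R z + \<sigma> *\<^sub>R x)"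
  shows "tree_conf K L z k l (f ` S) (f ` P) (f ` Q)"
proof -
  have diff: "f x - f y = \<sigma> *\<^sub>R (x - y)" for x y by (simp add: f algebra_simps)
  have inj: "inj f" using \<sigma> by (auto simp: f inj_on_def)
  have edge: "{s \<in> f ` S. f x - s \<in> M} = f ` {s\<in>S. x - s \<in> M}" if "conic M" for M x
    by (auto simp: diff conic_scaleR_mem_iff[OF that \<sigma>])
  have card: "card (f ` A) = card A" for A using inj by (metis card_image inj_on_subset subset_UNIV)
  have "f ` (P \<union> Q) \<subseteq> range (\<lambda>r. r *\<^sub>R z)"
  proof
    fix y assume "y \<in> f ` (P \<union> Q)"
    then obtain r where "y = \<mu> *\<^sub>R z + \<sigma> *\<^sub>R (r *\<^sub>R z)"
      using conf unfolding tree_conf_def f by blast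
    then have "y = (\<mu> + \<sigma> * r) *\<^sub>R z" by (simp add: algebra_simps)
    then show "y \<in> range (\<lambda>r. r *\<^sub>R z)" by blast
  qed
  moreover have "(\<exists>p\<in>f ` P. {s \<in> f ` S. p - s \<in> K} \<subseteq> R) \<or> (\<exists>q\<in>f ` Q. {s \<in> f ` S. q - s \<in> L} \<inter> R = {})" for R
  proof -
    have "(\<exists>p\<in>P. {s\<in>S. p - s \<in> K} \<subseteq> f -` R) \<or> (\<exists>q\<in>Q. {s\<in>S. q - s \<in> L} \<inter> f -` R = {})"
      using conf unfolding tree_conf_def by blast
    then show ?thesis unfolding bex_simps edge[OF K] edge[OF L] by blast
  qed
  moreover have "finite (f ` S)" "finite (f ` P)" "finite (f ` Q)"
    using conf by (auto simp: tree_conf_def)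
  moreover have "f p - f s \<in> K \<longrightarrow> f p - f s \<in> interior K" if "p \<in> P" "s \<in> S" for p s
    using conf that unfolding diff conic_scaleR_mem_iff[OF K \<sigma>] conic_scaleR_mem_interior_iff[OF K \<sigma>]
    by (auto simp: tree_conf_def)
  moreover have "f p - f s \<in> L \<longrightarrow> f p - f s \<in> interior L" if "p \<in> Q" "s \<in> S" for p s
    using conf that unfolding diff conic_scaleR_mem_iff[OF L \<sigma>] conic_scaleR_mem_interior_iff[OF L \<sigma>]
    by (auto simp: tree_conf_def)
  moreover have "\<forall>p\<in>P. k \<le> card {s \<in> S. p - s \<in> K}" "\<forall>q\<in>Q. l \<le> card {s \<in> S. q - s \<in> L}"
    using conf by (auto simp: tree_conf_def)
  ultimately show ?thesis
    unfolding tree_conf_def image_Un[symmetric] ball_simps edge[OF K] edge[OF L] card by blast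
qed

text \<open>The new root \<open>- X\<close> joins all \<open>P\<close>-edges near \<open>0\<close> and all \<open>Q\<close>-edges near \<open>- z\<close>, and no other edge; the two
  copies do not interact. According to the colour of the root one of the two copies does the job.\<close>

lemma tree_conf_step:
  assumes A: "tree_conf K L z k (Suc l) S P Q" "S \<union> P \<union> Q \<subseteq> ball 0 (\<rho>/2)"
    and B: "tree_conf K L z (Suc k) l S' P' Q'" "S' \<union> P' \<union> Q' \<subseteq> ball (-z) (\<rho>/2)"
    and X: "ball X \<rho> \<subseteq> interior K - L" and Y: "ball (X - z) \<rho> \<subseteq> interior L - K"
    and z: "ball z \<rho> \<inter> (K \<union> L) = {}" and mz: "ball (-z) \<rho> \<inter> (K \<union> L) = {}"
    and 0: "0 \<in> K" "0 \<in> L"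
  shows "tree_conf K L z (Suc k) (Suc l) (insert (-X) (S \<union> S')) (P \<union> P') (Q \<union> Q')"
proof -
  have nA: "norm a < \<rho>/2" if "a \<in> S \<union> P \<union> Q" for a using A(2) that by auto
  have nB: "norm (b + z) < \<rho>/2" if "b \<in> S' \<union> P' \<union> Q'" for b
  proof -
    have "dist (-z) b < \<rho>/2" using B(2) that by auto
    moreover have "-z - b = -(b + z)" by simp
    ultimately show ?thesis by (simp only: dist_norm norm_minus_cancel)
  qed
  have rootA: "a + X \<in> ball X \<rho>" if "a \<in> S \<union> P \<union> Q" for a
  proof -
    have "dist X (a + X) = norm a" by (simp add: dist_norm)
    then show ?thesis using nA[OF that] norm_ge_zero[of a] unfolding mem_ball by linarith
  qed
  have rootB: "b + X \<in> ball (X - z) \<rho>" if "b \<in> S' \<union> P' \<union> Q'" for b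
  proof -
    have "X - z - (b + X) = -(b + z)" by simp
    then have "dist (X - z) (b + X) = norm (b + z)" by (simp only: dist_norm norm_minus_cancel)
    then show ?thesis using nB[OF that] norm_ge_zero[of "b + z"] unfolding mem_ball by linarith
  qed
  have AB: "a - b \<in> ball z \<rho>" "b - a \<in> ball (-z) \<rho>" if "a \<in> S \<union> P \<union> Q" "b \<in> S' \<union> P' \<union> Q'" for a b
  proof -
    have "norm ((b + z) - a) < \<rho>" using norm_triangle_ineq4[of "b + z" a] nA[OF that(1)] nB[OF that(2)] by linarith
    moreover have "z - (a - b) = (b + z) - a" "-z - (b - a) = - ((b + z) - a)" by simp_all
    ultimately show "a - b \<in> ball z \<rho>" "b - a \<in> ball (-z) \<rho>"
      unfolding mem_ball dist_norm by (simp_all only: norm_minus_cancel)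
  qed
  \<comment> \<open>Otherwise \<open>0 = -X + X\<close> would lie in a ball that misses
    \<open>L\<close> or \<open>K\<close>. The root being new makes the enlarged edges grow by
    exactly one.\<close>
  have nroot: "-X \<notin> S" "-X \<notin> S'"
    using subsetD[OF X, of 0] subsetD[OF Y, of 0] rootA[of "-X"] rootB[of "-X"] 0 by auto
  let ?S = "insert (-X) (S \<union> S')"
  have mA: "a + X \<in> interior K" "a + X \<in> K" "a + X \<notin> L" if "a \<in> S \<union> P \<union> Q" for a
    using rootA[OF that] X interior_subset by blast+
  have mB: "b + X \<in> interior L" "b + X \<in> L" "b + X \<notin> K" if "b \<in> S' \<union> P' \<union> Q'" for b
    using rootB[OF that] Y interior_subset by blast+
  have mAB: "a - b \<notin> K" "a - b \<notin> L" "b - a \<notin> K" "b - a \<notin> L"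
    if "a \<in> S \<union> P \<union> Q" "b \<in> S' \<union> P' \<union> Q'" for a b
    using AB[OF that] z mz by blast+
  \<comment> \<open>For points \<open>p\<close> of the first copy, \<open>p + X\<close> lies in
    \<open>K\<close> and not in \<open>L\<close>; in the second copy it is the other way round.
    Differences between the copies are close to \<open>z\<close> or \<open>-z\<close>, outside both
    cones.\<close>
  have eA: "{s\<in>?S. p - s \<in> K} = insert (-X) {s\<in>S. p - s \<in> K}" "{s\<in>?S. p - s \<in> L} = {s\<in>S. p - s \<in> L}"
    if "p \<in> P \<union> Q" for p
    using mA[of p] mAB(1,2)[of p] that by auto
  have eB: "{s\<in>?S. p - s \<in> K} = {s\<in>S'. p - s \<in> K}" "{s\<in>?S. p - s \<in> L} = insert (-X) {s\<in>S'. p - s \<in> L}"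
    if "p \<in> P' \<union> Q'" for p
    using mB[of p] mAB(3,4)[of _ p] that by auto
  have fin: "finite S" "finite S'" using A(1) B(1) by (auto simp: tree_conf_def)
  have card: "card (insert (-X) {s\<in>S. p - s \<in> K}) = Suc (card {s\<in>S. p - s \<in> K})"
     "card (insert (-X) {s\<in>S'. p - s \<in> L}) = Suc (card {s\<in>S'. p - s \<in> L})" for p
    using nroot fin by auto
  have intA: "p - s \<in> interior K" if "p \<in> P" "s \<in> ?S" "p - s \<in> K" for p s
  proof -
    have "s \<in> {s\<in>?S. p - s \<in> K}" using that by blast
    then have "s \<in> S \<and> p - s \<in> K \<or> s = -X"
      using eA(1)[of p] that(1) by blast
    then show ?thesis
      using that A(1) mA[of p] unfolding tree_conf_def by auto
  qed
  have intA': "p - s \<in> interior L" if "p \<in> Q" "s \<in> ?S" "p - s \<in> L" for p s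
  proof -
    have "s \<in> {s\<in>?S. p - s \<in> L}" using that by blast
    then have "s \<in> S \<and> p - s \<in> L"
      using eA(2)[of p] that(1) by blast
    then show ?thesis
      using that A(1) unfolding tree_conf_def by auto
  qed
  have intB: "p - s \<in> interior K" if "p \<in> P'" "s \<in> ?S" "p - s \<in> K" for p s
  proof -
    have "s \<in> {s\<in>?S. p - s \<in> K}" using that by blast
    then have "s \<in> S' \<and> p - s \<in> K"
      using eB(1)[of p] that(1) by blast
    then show ?thesis
      using that B(1) unfolding tree_conf_def by auto
  qed
  have intB': "p - s \<in> interior L" if "p \<in> Q'" "s \<in> ?S" "p - s \<in> L" for p s
  proof -
    have "s \<in> {s\<in>?S. p - s \<in> L}" using that by blast
    then have "s \<in> S' \<and> p - s \<in> L \<or> s = -X"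
      using eB(2)[of p] that(1) by blast
    then show ?thesis
      using that B(1) mB[of p] unfolding tree_conf_def by auto
  qed
  have col: "(\<exists>p\<in>P \<union> P'. {s\<in>?S. p - s \<in> K} \<subseteq> R) \<or> (\<exists>q\<in>Q \<union> Q'. {s\<in>?S. q - s \<in> L} \<inter> R = {})" for R
  proof (cases "-X \<in> R")
    case True
    have "(\<exists>p\<in>P. {s\<in>S. p - s \<in> K} \<subseteq> R) \<or> (\<exists>q\<in>Q. {s\<in>S. q - s \<in> L} \<inter> R = {})"
      using A(1) unfolding tree_conf_def by blast
    then show ?thesis
    proof
      assume "\<exists>p\<in>P. {s\<in>S. p - s \<in> K} \<subseteq> R"
      then obtain p where "p \<in> P" "{s\<in>S. p - s \<in> K} \<subseteq> R" ..
      with True eA(1)[of p] have "{s\<in>?S. p - s \<in> K} \<subseteq> R" by auto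
      then show ?thesis using \<open>p \<in> P\<close> by blast
    next
      assume "\<exists>q\<in>Q. {s\<in>S. q - s \<in> L} \<inter> R = {}"
      then obtain p where "p \<in> Q" "{s\<in>S. p - s \<in> L} \<inter> R = {}" ..
      with eA(2)[of p] have "{s\<in>?S. p - s \<in> L} \<inter> R = {}" by auto
      then show ?thesis using \<open>p \<in> Q\<close> by blast
    qed
  next
    case False
    have "(\<exists>p\<in>P'. {s\<in>S'. p - s \<in> K} \<subseteq> R) \<or> (\<exists>q\<in>Q'. {s\<in>S'. q - s \<in> L} \<inter> R = {})"
      using B(1) unfolding tree_conf_def by blast
    then show ?thesis
    proof
      assume "\<exists>p\<in>P'. {s\<in>S'. p - s \<in> K} \<subseteq> R"
      then obtain p where "p \<in> P'" "{s\<in>S'. p - s \<in> K} \<subseteq> R" ..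
      with eB(1)[of p] have "{s\<in>?S. p - s \<in> K} \<subseteq> R" by auto
      then show ?thesis using \<open>p \<in> P'\<close> by blast
    next
      assume "\<exists>q\<in>Q'. {s\<in>S'. q - s \<in> L} \<inter> R = {}"
      then obtain p where "p \<in> Q'" "{s\<in>S'. p - s \<in> L} \<inter> R = {}" ..
      with False eB(2)[of p] have "{s\<in>?S. p - s \<in> L} \<inter> R = {}" by auto
      then show ?thesis using \<open>p \<in> Q'\<close> by blast
    qed
  qed
  have dA: "\<forall>p\<in>P. k \<le> card {s\<in>S. p - s \<in> K}" "\<forall>q\<in>Q. Suc l \<le> card {s\<in>S. q - s \<in> L}"
    and dB: "\<forall>p\<in>P'. Suc k \<le> card {s\<in>S'. p - s \<in> K}" "\<forall>q\<in>Q'. l \<le> card {s\<in>S'. q - s \<in> L}"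
    using A(1) B(1) by (simp_all add: tree_conf_def)
  have degK: "Suc k \<le> card {s\<in>?S. p - s \<in> K}" if "p \<in> P \<union> P'" for p
    using that
  proof
    assume p: "p \<in> P"
    then have h: "p \<in> P \<union> Q" by blast
    show ?thesis unfolding eA(1)[OF h] card(1) using bspec[OF dA(1) p] by simp
  next
    assume p: "p \<in> P'"
    then have h: "p \<in> P' \<union> Q'" by blast
    show ?thesis unfolding eB(1)[OF h] using bspec[OF dB(1) p] .
  qed
  have degL: "Suc l \<le> card {s\<in>?S. p - s \<in> L}" if "p \<in> Q \<union> Q'" for p
    using that
  proof
    assume p: "p \<in> Q"
    then have h: "p \<in> P \<union> Q" by blast
    show ?thesis unfolding eA(2)[OF h] using bspec[OF dA(2) p] .
  next
    assume p: "p \<in> Q'"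
    then have h: "p \<in> P' \<union> Q'" by blast
    show ?thesis unfolding eB(2)[OF h] card(2) using bspec[OF dB(2) p] by simp
  qed
  have "finite ?S" "finite (P \<union> P')" "finite (Q \<union> Q')" "P \<union> P' \<union> (Q \<union> Q') \<subseteq> range (\<lambda>r. r *\<^sub>R z)"
    using A(1) B(1) by (simp_all add: tree_conf_def)
  moreover have "\<forall>p\<in>P \<union> P'. \<forall>s\<in>?S. p - s \<in> K \<longrightarrow> p - s \<in> interior K"
    using intA intB by blast
  moreover have "\<forall>p\<in>Q \<union> Q'. \<forall>s\<in>?S. p - s \<in> L \<longrightarrow> p - s \<in> interior L"
    using intA' intB' by blast
  moreover have "\<forall>p\<in>P \<union> P'. Suc k \<le> card {s\<in>?S. p - s \<in> K}"
    using degK by blast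
  moreover have "\<forall>q\<in>Q \<union> Q'. Suc l \<le> card {s\<in>?S. q - s \<in> L}"
    using degL by blast
  moreover have "\<forall>R. (\<exists>p\<in>P \<union> P'. {s\<in>?S. p - s \<in> K} \<subseteq> R) \<or> (\<exists>q\<in>Q \<union> Q'. {s\<in>?S. q - s \<in> L} \<inter> R = {})"
    using col by (rule allI)
  ultimately show ?thesis
    unfolding tree_conf_def by (intro conjI)
qed

text \<open>Double induction: the case \<open>(Suc k, Suc l)\<close> joins a copy for
  \<open>(k, Suc l)\<close> near \<open>0\<close> and one for \<open>(Suc k, l)\<close> near
  \<open>- (X - Y)\<close>. The radius is arbitrary because the copies must be small enough for the
  open conditions on \<open>X\<close>, \<open>Y\<close> and their differences to persist.\<close>

lemma tree_conf_exists:
  fixes K L :: "'a::euclidean_space set"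
  assumes K: "conic K" "closed K" and L: "conic L" "closed L"
    and X: "X \<in> interior K" "X \<notin> L" and Y: "Y \<in> interior L" "Y \<notin> K"
    and z: "X - Y \<notin> K \<union> L" "Y - X \<notin> K \<union> L" and "0 < r"
  shows "\<exists>S P Q. tree_conf K L (X - Y) k l S P Q \<and> S \<union> P \<union> Q \<subseteq> ball 0 r"
  using \<open>0 < r\<close>
proof (induction k arbitrary: l r)
  case 0
  \<comment> \<open>Without vertices the edge of \<open>0\<close> is empty, hence contained in every
    \<open>R\<close>. For \<open>l = 0\<close> the empty edge is put into \<open>Q\<close>, where it
    is disjoint from every \<open>R\<close>.\<close>
  have "tree_conf K L (X - Y) 0 l {} {0} {}" by (auto simp: tree_conf_def intro!: range_eqI[of _ _ 0])
  then show ?case using 0 by force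
next
  case (Suc k)
  note IH = Suc.IH
  show ?case using Suc.prems
  proof (induction l arbitrary: r)
    case 0
    have "tree_conf K L (X - Y) (Suc k) 0 {} {} {0}" by (auto simp: tree_conf_def intro!: range_eqI[of _ _ 0])
    then show ?case using 0 by force
  next
    case (Suc l)
    have "open (interior K - L)" "open (interior L - K)" "open (- (K \<union> L))"
      using K(2) L(2) by (auto intro: open_Diff)
    then obtain r1 r2 r3 r4 where r: "0 < r1" "0 < r2" "0 < r3" "0 < r4"
      "ball X r1 \<subseteq> interior K - L" "ball Y r2 \<subseteq> interior L - K"
      "ball (X - Y) r3 \<subseteq> - (K \<union> L)" "ball (-(X - Y)) r4 \<subseteq> - (K \<union> L)"
      using X Y z by (metis Compl_iff DiffI minus_diff_eq open_contains_ball)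
    define \<rho> where "\<rho> = min (min r1 r2) (min r3 r4)"
    have \<rho>: "0 < \<rho>" "\<rho> \<le> r1" "\<rho> \<le> r2" "\<rho> \<le> r3" "\<rho> \<le> r4" using r by (auto simp: \<rho>_def)
    obtain S P Q where A: "tree_conf K L (X - Y) k (Suc l) S P Q" "S \<union> P \<union> Q \<subseteq> ball 0 (\<rho>/2)"
      using IH[of "\<rho>/2" "Suc l"] \<open>0 < \<rho>\<close> by auto
    obtain S' P' Q' where B: "tree_conf K L (X - Y) (Suc k) l S' P' Q'" "S' \<union> P' \<union> Q' \<subseteq> ball 0 (\<rho>/2)"
      using Suc.IH[of "\<rho>/2"] \<open>0 < \<rho>\<close> by auto
    define f where "f x = (-1) *\<^sub>R (X - Y) + 1 *\<^sub>R x" for x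
    have B': "tree_conf K L (X - Y) (Suc k) l (f ` S') (f ` P') (f ` Q')"
      by (rule tree_conf_affine_image[OF B(1) K(1) L(1) zero_less_one, of _ "-1"]) (simp add: f_def[abs_def])
    have B'': "f ` S' \<union> f ` P' \<union> f ` Q' \<subseteq> ball (-(X - Y)) (\<rho>/2)"
      using B(2) by (force simp: f_def dist_norm)
    have "0 \<in> K" "0 \<in> L" using X(1) Y(1) K(1) L(1) interior_subset conic_contains_0 by blast+
    then have conf: "tree_conf K L (X - Y) (Suc k) (Suc l) (insert (-X) (S \<union> f ` S')) (P \<union> f ` P') (Q \<union> f ` Q')"
      using r(5-8) subset_ball[OF \<rho>(2), of X] subset_ball[OF \<rho>(3), of Y]
        subset_ball[OF \<rho>(4), of "X - Y"] subset_ball[OF \<rho>(5), of "-(X - Y)"]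
      by (intro tree_conf_step[OF A B' B'']) (simp_all, blast+)
    let ?S = "insert (-X) (S \<union> f ` S')" and ?P = "P \<union> f ` P'" and ?Q = "Q \<union> f ` Q'"
    have "finite (?S \<union> ?P \<union> ?Q)" using conf by (auto simp: tree_conf_def)
    then obtain M where M: "0 < M" "\<And>x. x \<in> ?S \<union> ?P \<union> ?Q \<Longrightarrow> norm x \<le> M"
      using bounded_pos finite_imp_bounded by metis
    define g where "g x = 0 *\<^sub>R (X - Y) + (r / (2 * M)) *\<^sub>R x" for x :: 'a
    have "norm (g x) < r" if "x \<in> ?S \<union> ?P \<union> ?Q" for x
    proof -
      have "norm (g x) = r / (2 * M) * norm x" using M(1) Suc.prems by (simp add: g_def)
      also have "\<dots> \<le> r / (2 * M) * M" using M Suc.prems that by (intro mult_left_mono) auto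
      also have "\<dots> < r" using M(1) Suc.prems by simp
      finally show ?thesis .
    qed
    then have "g ` ?S \<union> g ` ?P \<union> g ` ?Q \<subseteq> ball 0 r" by (auto simp del: image_insert)
    moreover have "tree_conf K L (X - Y) (Suc k) (Suc l) (g ` ?S) (g ` ?P) (g ` ?Q)"
      using M(1) Suc.prems
      by (intro tree_conf_affine_image[OF conf K(1) L(1), of "r / (2 * M)" _ 0]) (auto simp: g_def)
    ultimately show ?case by blast
  qed
qed

section \<open>Generic vectors and lines\<close>

text \<open>Hyperplanes are closed with empty interior, so removing them one by one from
  \<open>U\<close> leaves a nonempty open set.\<close>

lemma generic_vector_exists:
  fixes G :: "'a::euclidean_space set"
  assumes "finite G" "0 \<notin> G" "open U" "U \<noteq> {}"
  obtains b where "b \<in> U" "\<And>g. g \<in> G \<Longrightarrow> b \<bullet> g \<noteq> 0"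
proof -
  have "\<exists>b\<in>U. \<forall>g\<in>G. b \<bullet> g \<noteq> 0"
    using assms
  proof (induction arbitrary: U rule: finite_induct)
    case (insert g G)
    have "interior {x. g \<bullet> x = 0} = {}" using insert.prems(1) by (intro interior_hyperplane) auto
    then have "\<not> U \<subseteq> {x. g \<bullet> x = 0}" using insert.prems(2,3) interior_maximal by blast
    moreover have "open (U - {x. g \<bullet> x = 0})"
      using insert.prems(2) closed_hyperplane by (rule open_Diff)
    ultimately obtain b where "b \<in> U - {x. g \<bullet> x = 0}" "\<forall>g\<in>G. b \<bullet> g \<noteq> 0"
      using insert.IH[of "U - {x. g \<bullet> x = 0}"] insert.prems(1) by blast
    then show ?case by (intro bexI[of _ b]) (auto simp: inner_commute)
  qed auto
  then show ?thesis using that by blast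
qed

text \<open>This is where dimension at least 3 enters: two vectors span at most a plane.\<close>

lemma orthogonal_pair_exists:
  fixes x y :: "'a::euclidean_space"
  assumes "DIM('a) \<ge> 3"
  obtains e where "e \<noteq> 0" "e \<bullet> x = 0" "e \<bullet> y = 0"
proof -
  have "dim {x, y} \<le> card {x, y}" by (rule dim_le_card') simp
  also have "\<dots> \<le> 2" by (simp add: card_insert_if)
  finally obtain e where e: "e \<noteq> 0" "\<And>v. v \<in> span {x, y} \<Longrightarrow> orthogonal e v"
    using orthogonal_to_subspace_exists[of "{x, y}"] assms by auto
  then have "orthogonal e x" "orthogonal e y" by (auto intro: span_base)
  then show ?thesis using that e(1) by (auto simp: orthogonal_def)
qed

text \<open>A line that misses all pairwise intersections of the hyperplanes \<open>{a. a \<bullet> g = 0}\<close>, apart from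
  coinciding hyperplanes, as a generic line misses a set of codimension two.\<close>

lemma generic_line_exists:
  fixes G :: "'a::euclidean_space set"
  assumes "finite G" "0 \<notin> G" "DIM('a) \<ge> 2"
  obtains b c :: 'a where "c \<noteq> 0" "\<And>t. b + t *\<^sub>R c \<noteq> 0"
    "\<And>t. \<exists>u. \<forall>g\<in>G. (b + t *\<^sub>R c) \<bullet> g = 0 \<longrightarrow> g \<in> span {u}"
proof -
  \<comment> \<open>The basis is included to keep the line away from \<open>0\<close>: there any two
    members of \<open>H\<close> would have to be parallel.\<close>
  define H where "H = G \<union> Basis"
  have H: "finite H" "0 \<notin> H" using assms by (auto simp: H_def nonzero_Basis)
  obtain b where b: "\<And>g. g \<in> H \<Longrightarrow> b \<bullet> g \<noteq> 0"
    using generic_vector_exists[OF H open_UNIV] by blast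
  \<comment> \<open>The combinations of \<open>g\<close> and \<open>h\<close> orthogonal to
    \<open>b\<close>. If \<open>b + t *\<^sub>R c\<close> is orthogonal to \<open>g\<close> and
    \<open>h\<close>, it is orthogonal to such a \<open>d\<close>, so
    \<open>t * (c \<bullet> d) = 0\<close>; a nonzero \<open>d\<close> forces \<open>t = 0\<close>,
    against \<open>b \<bullet> g \<noteq> 0\<close>.\<close>
  define D where "D = (\<lambda>(g, h). (b \<bullet> h) *\<^sub>R g - (b \<bullet> g) *\<^sub>R h) ` (H \<times> H) - {0}"
  have "finite D" "0 \<notin> D" using H by (auto simp: D_def)
  moreover have "open (- {0 :: 'a})" by (simp add: open_Compl)
  moreover have "- {0 :: 'a} \<noteq> {}" using nonempty_Basis nonzero_Basis by blast
  ultimately obtain c where c: "c \<in> - {0}" "\<And>g. g \<in> D \<Longrightarrow> c \<bullet> g \<noteq> 0"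
    by (rule generic_vector_exists) blast
  have par: "(b \<bullet> h) *\<^sub>R g = (b \<bullet> g) *\<^sub>R h"
    if "g \<in> H" "h \<in> H" "(b + t *\<^sub>R c) \<bullet> g = 0" "(b + t *\<^sub>R c) \<bullet> h = 0" for g h t
  proof (rule ccontr)
    let ?d = "(b \<bullet> h) *\<^sub>R g - (b \<bullet> g) *\<^sub>R h"
    assume "(b \<bullet> h) *\<^sub>R g \<noteq> (b \<bullet> g) *\<^sub>R h"
    then have "?d \<in> D" using that(1,2) by (auto simp: D_def)
    then have "c \<bullet> ?d \<noteq> 0" using c(2) by blast
    moreover have "(b + t *\<^sub>R c) \<bullet> ?d = 0" unfolding inner_diff_right inner_scaleR_right that(3,4) by simp
    moreover have "b \<bullet> ?d = 0" by (simp add: inner_diff_right)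
    ultimately have "t = 0" by (simp add: inner_add_left)
    then show False using that(1,3) b by simp
  qed
  show ?thesis
  proof
    show "c \<noteq> 0" using c(1) by simp
    show "b + t *\<^sub>R c \<noteq> 0" for t
    proof
      assume 0: "b + t *\<^sub>R c = 0"
      obtain B :: "'a set" where "B \<subseteq> Basis" "card B = 2"
        using obtain_subset_with_card_n[OF assms(3)] by metis
      then obtain i j :: 'a where ij: "i \<in> Basis" "j \<in> Basis" "i \<noteq> j"
        by (auto simp: card_2_iff)
      then have "(b \<bullet> j) *\<^sub>R i = (b \<bullet> i) *\<^sub>R j" using par[of i j t] 0 by (auto simp: H_def)
      then have "((b \<bullet> j) *\<^sub>R i) \<bullet> i = ((b \<bullet> i) *\<^sub>R j) \<bullet> i" by simp
      then show False using ij b[of j] by (simp add: inner_Basis H_def)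
    qed
    show "\<exists>u. \<forall>g\<in>G. (b + t *\<^sub>R c) \<bullet> g = 0 \<longrightarrow> g \<in> span {u}" for t
    proof (cases "\<exists>u\<in>G. (b + t *\<^sub>R c) \<bullet> u = 0")
      case True
      then obtain u where u: "u \<in> G" "(b + t *\<^sub>R c) \<bullet> u = 0" by blast
      have "g \<in> span {u}" if "g \<in> G" "(b + t *\<^sub>R c) \<bullet> g = 0" for g
      proof -
        have "(b \<bullet> u) *\<^sub>R g = (b \<bullet> g) *\<^sub>R u" using par[of g u t] that u by (auto simp: H_def)
        then have "g = (b \<bullet> g / (b \<bullet> u)) *\<^sub>R u"
          using b[of u] u(1) by (simp add: H_def eq_vector_fraction_iff)
        then show ?thesis by (metis span_base span_scale singletonI)
      qed
      then show ?thesis by blast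
    qed auto
  qed
qed

section \<open>Tangent cones of polyhedral sets\<close>

text \<open>The tangent cone with a radius of agreement. For \<open>c\<close> outside
  \<open>S\<close> it is empty, as a nonempty conic set contains \<open>0\<close>.\<close>

definition local_cone :: "'a::euclidean_space set \<Rightarrow> 'a \<Rightarrow> 'a set \<Rightarrow> real \<Rightarrow> bool" where
  "local_cone S c K r \<longleftrightarrow> closed K \<and> conic K \<and> 0 < r \<and> (\<forall>w. norm w < r \<longrightarrow> (c + w \<in> S \<longleftrightarrow> w \<in> K))"

lemma local_cone_halfspace: "\<exists>K r. local_cone {x. a \<bullet> x \<le> b} c K r"
proof -
  consider "a \<bullet> c < b" | "a \<bullet> c = b" | "a \<bullet> c > b" by linarith
  then show ?thesis
  proof cases
    case 1
    then have "c \<in> {x. a \<bullet> x < b}" by simp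
    then obtain r where r: "0 < r" "ball c r \<subseteq> {x. a \<bullet> x < b}"
      using open_halfspace_lt open_contains_ball by blast
    have "c + w \<in> {x. a \<bullet> x \<le> b}" if "norm w < r" for w
    proof -
      have "c + w \<in> ball c r" using that by (simp add: dist_norm)
      then show ?thesis using r(2) by (auto dest: subsetD)
    qed
    then have "local_cone {x. a \<bullet> x \<le> b} c UNIV r"
      unfolding local_cone_def using r(1) conic_UNIV by blast
    then show ?thesis by blast
  next
    case 2
    have "closed {w. a \<bullet> w \<le> 0}" by (rule closed_halfspace_le)
    moreover have "conic {w. a \<bullet> w \<le> 0}" by (rule conic_halfspace_le)
    ultimately have "local_cone {x. a \<bullet> x \<le> b} c {w. a \<bullet> w \<le> 0} 1"
      using 2 by (simp add: local_cone_def inner_add_right)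
    then show ?thesis by blast
  next
    case 3
    then have "c \<in> {x. a \<bullet> x > b}" by simp
    then obtain r where r: "0 < r" "ball c r \<subseteq> {x. a \<bullet> x > b}"
      using open_halfspace_gt open_contains_ball by blast
    have "c + w \<notin> {x. a \<bullet> x \<le> b}" if "norm w < r" for w
    proof -
      have "c + w \<in> ball c r" using that by (simp add: dist_norm)
      then show ?thesis using r(2) by (auto dest: subsetD)
    qed
    then have "local_cone {x. a \<bullet> x \<le> b} c {} r"
      unfolding local_cone_def using r(1) conic_empty by blast
    then show ?thesis by blast
  qed
qed

lemma local_cone_Int:
  assumes "local_cone S c K r" "local_cone T c L s"
  shows "local_cone (S \<inter> T) c (K \<inter> L) (min r s)"
proof -
  have "conic (K \<inter> L)" using assms unfolding local_cone_def conic_def by blast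
  then show ?thesis using assms unfolding local_cone_def by (simp add: closed_Int)
qed

lemma local_cone_Un:
  assumes "local_cone S c K r" "local_cone T c L s"
  shows "local_cone (S \<union> T) c (K \<union> L) (min r s)"
proof -
  have "conic (K \<union> L)" using assms unfolding local_cone_def conic_def by blast
  then show ?thesis using assms unfolding local_cone_def by (simp add: closed_Un)
qed

lemma local_cone_polyhedron:
  assumes "polyhedron S"
  shows "\<exists>K r. local_cone S c K r"
proof -
  obtain F where F: "finite F" "S = \<Inter>F" "\<forall>h\<in>F. \<exists>a b. a \<noteq> 0 \<and> h = {x. a \<bullet> x \<le> b}"
    using assms by (auto simp: polyhedron_def)
  have "\<exists>K r. local_cone (\<Inter>F) c K r"
    using F(1,3)
  proof (induction rule: finite_induct)
    case empty
    have "local_cone (\<Inter>{}) c UNIV 1" by (simp add: local_cone_def conic_UNIV)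
    then show ?case by blast
  next
    case (insert h F)
    then obtain K r where K: "local_cone (\<Inter>F) c K r" by auto
    obtain a b where "h = {x. a \<bullet> x \<le> b}" using insert.prems by auto
    then obtain L s where L: "local_cone h c L s" using local_cone_halfspace by blast
    show ?case unfolding Inter_insert using local_cone_Int[OF L K] by (intro exI)
  qed
  then show ?thesis using F(2) by simp
qed

lemma local_cone_polyhedral_set:
  assumes "finite F" "\<And>S. S \<in> F \<Longrightarrow> polyhedron S"
  shows "\<exists>K r. local_cone (\<Union>F) c K r"
  using assms
proof (induction rule: finite_induct)
  case empty
  have "local_cone (\<Union>{}) c {} 1" by (simp add: local_cone_def conic_empty)
  then show ?case by blast
next
  case (insert h F)
  then obtain K r where K: "local_cone (\<Union>F) c K r" by auto
  obtain L s where L: "local_cone h c L s"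
    using local_cone_polyhedron[OF insert.prems, of h] by blast
  show ?case unfolding Union_insert using local_cone_Un[OF L K] by (intro exI)
qed

lemma local_cone_interior:
  assumes "local_cone P c K r" "norm w < r"
  shows "c + w \<in> interior P \<longleftrightarrow> w \<in> interior K"
proof -
  have "(+) c ` (K \<inter> ball 0 r) = P \<inter> ball c r"
  proof (intro equalityI subsetI)
    fix x assume x: "x \<in> P \<inter> ball c r"
    then have "norm (x - c) < r" by (simp add: dist_norm norm_minus_commute)
    moreover from this have "c + (x - c) \<in> P \<longleftrightarrow> x - c \<in> K"
      using assms(1) unfolding local_cone_def by blast
    ultimately have "x - c \<in> K \<inter> ball 0 r" using x by simp
    then show "x \<in> (+) c ` (K \<inter> ball 0 r)" by (rule rev_image_eqI) simp
  next
    fix x assume "x \<in> (+) c ` (K \<inter> ball 0 r)"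
    then have "x - c \<in> K" "norm (x - c) < r" by (simp_all add: translate_mem_iff)
    moreover from this have "c + (x - c) \<in> P \<longleftrightarrow> x - c \<in> K"
      using assms(1) unfolding local_cone_def by blast
    ultimately show "x \<in> P \<inter> ball c r" by (simp add: dist_norm norm_minus_commute)
  qed
  then have "(+) c ` (interior K \<inter> ball 0 r) = interior P \<inter> ball c r"
    using interior_translation[of c "K \<inter> ball 0 r"] by (simp add: interior_Int interior_open)
  moreover have "c + w \<in> ball c r" using assms(2) by (simp add: dist_norm)
  moreover have "w \<in> ball 0 r" using assms(2) by simp
  ultimately have "c + w \<in> (+) c ` (interior K \<inter> ball 0 r) \<longleftrightarrow> c + w \<in> interior P" by simp
  then show ?thesis using \<open>w \<in> ball 0 r\<close> by (auto simp: translate_mem_iff)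
qed

lemma local_cone_shrink:
  assumes "local_cone P c K r" "w \<in> K"
  obtains t where "0 < t" "norm (t *\<^sub>R w) < r" "t *\<^sub>R w \<in> K" "c + t *\<^sub>R w \<in> P"
proof -
  \<comment> \<open>The added 1 keeps the divisor positive when \<open>w = 0\<close>.\<close>
  define a where "a = norm w + 1"
  define t where "t = r / (2 * a)"
  have r: "0 < r" using assms(1) by (simp add: local_cone_def)
  have a: "0 < a" "norm w \<le> a" using norm_ge_zero[of w] unfolding a_def by linarith+
  have t: "0 < t" using r a(1) by (simp add: t_def)
  have "t * norm w \<le> t * a" using t a(2) by simp
  also have "\<dots> = r / 2" using a(1) by (simp add: t_def)
  also have "\<dots> < r" using r by simp
  finally have n: "norm (t *\<^sub>R w) < r" using t by simp
  moreover have "t *\<^sub>R w \<in> K" using assms t by (auto simp: local_cone_def conic_def)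
  ultimately show ?thesis using that[OF t] assms(1) by (auto simp: local_cone_def)
qed

text \<open>The nonnegative terms \<open>u v * (m - a \<bullet> v)\<close> sum to 0, so only points
  at the maximal level carry weight.\<close>

lemma convex_hull_face_subset:
  fixes a :: "'a::euclidean_space"
  assumes "finite V" "x \<in> convex hull V" "\<And>v. v \<in> V \<Longrightarrow> a \<bullet> v \<le> m" "a \<bullet> x = m"
  shows "x \<in> convex hull {v\<in>V. a \<bullet> v = m}"
proof -
  obtain u where u: "\<forall>v\<in>V. 0 \<le> u v" "sum u V = 1" "(\<Sum>v\<in>V. u v *\<^sub>R v) = x"
    using assms(2) by (auto simp: convex_hull_finite[OF assms(1)])
  have "(\<Sum>v\<in>V. u v * (m - a \<bullet> v)) = m * sum u V - a \<bullet> (\<Sum>v\<in>V. u v *\<^sub>R v)"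
    by (simp add: inner_sum_right right_diff_distrib sum_subtractf sum_distrib_left mult.commute[of m])
  then have "(\<Sum>v\<in>V. u v * (m - a \<bullet> v)) = 0" using u assms(4) by simp
  then have "\<forall>v\<in>V. u v * (m - a \<bullet> v) = 0"
    using u(1) assms(3) by (subst (asm) sum_nonneg_eq_0_iff[OF assms(1)]) simp_all
  then have z: "u v = 0" if "v \<in> V" "v \<notin> {v\<in>V. a \<bullet> v = m}" for v using that by auto
  let ?W = "{v\<in>V. a \<bullet> v = m}"
  have "sum u ?W = sum u V" "(\<Sum>v\<in>?W. u v *\<^sub>R v) = (\<Sum>v\<in>V. u v *\<^sub>R v)"
    using assms(1) z by (intro sum.mono_neutral_left; simp)+
  moreover have fin: "finite ?W" using assms(1) by simp
  ultimately show ?thesis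
    unfolding convex_hull_finite[OF fin] using u by (intro CollectI exI[of _ u]) simp
qed

text \<open>Scale \<open>w\<close> into the ball of agreement, approximate it there by interior
  points of \<open>P\<close>, and scale back. Thus a tangent cone not contained in a closed set has
  interior points outside that set.\<close>

lemma local_cone_subset_closure_interior:
  assumes K: "local_cone P c K r" and P: "P = closure (interior P)"
  shows "K \<subseteq> closure (interior K)"
proof
  fix w assume w: "w \<in> K"
  have "conic K" using K by (simp add: local_cone_def)
  obtain t where t: "0 < t" "norm (t *\<^sub>R w) < r" "c + t *\<^sub>R w \<in> P"
    using local_cone_shrink[OF K w] by metis
  show "w \<in> closure (interior K)"
    unfolding closure_approachable
  proof (intro allI impI)
    fix e :: real assume e: "0 < e"
    define d where "d = min (t * e) (r - norm (t *\<^sub>R w))"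
    have "0 < d" using t e by (simp add: d_def)
    then obtain y where y: "y \<in> interior P" "dist y (c + t *\<^sub>R w) < d"
      using t(3) P closure_approachable by metis
    have n: "norm ((y - c) - t *\<^sub>R w) < d" using y(2) by (simp add: dist_norm algebra_simps)
    then have "norm (y - c) < r"
      using norm_triangle_sub[of "y - c" "t *\<^sub>R w"] unfolding d_def by linarith
    then have "y - c \<in> interior K" using local_cone_interior[OF K] y(1) by force
    moreover have eq: "y - c = t *\<^sub>R ((1/t) *\<^sub>R (y - c))" using t(1) by simp
    ultimately have "(1/t) *\<^sub>R (y - c) \<in> interior K"
      using conic_scaleR_mem_interior_iff[OF \<open>conic K\<close> t(1)] by metis
    moreover have "t * norm ((1/t) *\<^sub>R (y - c) - w) = norm ((y - c) - t *\<^sub>R w)"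
    proof -
      have "(y - c) - t *\<^sub>R w = t *\<^sub>R ((1/t) *\<^sub>R (y - c) - w)"
        using t(1) by (simp add: scaleR_diff_right)
      then show ?thesis using t(1) by simp
    qed
    then have "t * dist ((1/t) *\<^sub>R (y - c)) w < t * e" using n by (simp add: dist_norm d_def)
    then have "dist ((1/t) *\<^sub>R (y - c)) w < e" using t(1) by simp
    ultimately show "\<exists>y\<in>interior K. dist y w < e" by blast
  qed
qed

section \<open>Two suitable tangent cones\<close>

lemma nonnested_pair_exists:
  fixes b c :: "'a::euclidean_space" and K :: "'i \<Rightarrow> 'a set"
  assumes V: "finite V" and cov: "\<And>t. \<exists>i\<in>V. \<forall>w\<in>K i. (b + t *\<^sub>R c) \<bullet> w \<le> 0"
    and int: "\<And>i. i \<in> V \<Longrightarrow> interior (K i) \<noteq> {}" and c: "c \<noteq> 0"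
  obtains t i j where "i \<in> V" "j \<in> V"
    "\<And>w. w \<in> K i \<union> K j \<Longrightarrow> (b + t *\<^sub>R c) \<bullet> w \<le> 0" "\<not> K i \<subseteq> K j" "\<not> K j \<subseteq> K i"
proof -
  define J where "J i = {t. \<forall>w\<in>K i. (b + t *\<^sub>R c) \<bullet> w \<le> 0}" for i
  have anti: "J j \<subseteq> J i" if "K i \<subseteq> K j" for i j using that by (auto simp: J_def)
  have "\<exists>i\<in>V. \<exists>j\<in>V. J i \<inter> J j \<noteq> {} \<and> \<not> K i \<subseteq> K j \<and> \<not> K j \<subseteq> K i"
  proof (rule ccontr)
    assume neg: "\<not> ?thesis"
    have nest: "J j \<subseteq> J i \<or> J i \<subseteq> J j" if "i \<in> V" "j \<in> V" "J i \<inter> J j \<noteq> {}" for i j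
    proof -
      have "K i \<subseteq> K j \<or> K j \<subseteq> K i" using neg that by blast
      then show ?thesis using anti[of i j] anti[of j i] by blast
    qed
    have closed: "closed (J i)" for i
    proof -
      have "J i = (\<Inter>w\<in>K i. {t. (b + t *\<^sub>R c) \<bullet> w \<le> 0})" unfolding J_def by blast
      moreover have "closed {t. (b + t *\<^sub>R c) \<bullet> w \<le> 0}" for w
        by (intro closed_Collect_le continuous_intros)
      ultimately show ?thesis by auto
    qed
    define JJ where "JJ = J ` V"
    have JJ: "finite JJ" "\<And>N. N \<in> JJ \<Longrightarrow> closed N"
      "\<And>M N. M \<in> JJ \<Longrightarrow> N \<in> JJ \<Longrightarrow> M \<inter> N \<noteq> {} \<Longrightarrow> M \<subseteq> N \<or> N \<subseteq> M"
      using V closed nest by (auto simp: JJ_def)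
    have cover: "\<exists>N\<in>JJ. t \<in> N" for t using cov[of t] by (auto simp: JJ_def J_def)
    then obtain N0 where "N0 \<in> {N \<in> JJ. 0 \<in> N}" by blast
    moreover have "finite {N \<in> JJ. 0 \<in> N}" using JJ(1) by simp
    ultimately have "\<exists>M\<in>{N \<in> JJ. 0 \<in> N}. N0 \<subseteq> M \<and> (\<forall>N\<in>{N \<in> JJ. 0 \<in> N}. M \<subseteq> N \<longrightarrow> M = N)"
      using finite_has_maximal2[of "{N \<in> JJ. 0 \<in> N}" N0] by simp
    then obtain M where M: "M \<in> JJ" "0 \<in> M"
        and max: "\<And>N. N \<in> JJ \<Longrightarrow> 0 \<in> N \<Longrightarrow> M \<subseteq> N \<Longrightarrow> M = N"
      by auto
    \<comment> \<open>A member of \<open>JJ\<close> that meets \<open>M\<close> without lying inside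
      it would contain \<open>M\<close> properly, against maximality. So \<open>M\<close> and
      \<open>U\<close> split the line into disjoint closed sets.\<close>
    define U where "U = \<Union>{N \<in> JJ. \<not> N \<subseteq> M}"
    have closed_U: "closed U" unfolding U_def using JJ(1,2) by (intro closed_Union) auto
    have disj: "M \<inter> U = {}"
    proof (rule ccontr)
      assume "M \<inter> U \<noteq> {}"
      then obtain N where N: "N \<in> JJ" "\<not> N \<subseteq> M" "M \<inter> N \<noteq> {}" by (auto simp: U_def)
      then have "M \<subseteq> N" using JJ(3)[OF M(1) N(1)] by simp
      then show False using max[OF N(1)] M(2) N(2) by auto
    qed
    have MU: "UNIV \<subseteq> M \<union> U"
    proof
      fix t
      obtain N where "N \<in> JJ" "t \<in> N" using cover[of t] by auto
      then show "t \<in> M \<union> U" by (auto simp: U_def)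
    qed
    then have "U = {}"
      using connected_closedD[OF connected_UNIV, of M U] disj JJ(2)[OF M(1)] closed_U M(2) by auto
    then have "M = UNIV" using MU by auto
    then obtain i where i: "i \<in> V" "J i = UNIV" using M(1) by (auto simp: JJ_def)
    \<comment> \<open>For fixed \<open>w\<close> the value is affine in the parameter, and a
      nonconstant affine function takes the value 1.\<close>
    have "K i \<subseteq> {w. c \<bullet> w = 0}"
    proof safe
      fix w assume w: "w \<in> K i"
      show "c \<bullet> w = 0"
      proof (rule ccontr)
        assume "c \<bullet> w \<noteq> 0"
        then have "(b + ((1 - b \<bullet> w) / (c \<bullet> w)) *\<^sub>R c) \<bullet> w = 1" by (simp add: inner_add_left)
        moreover have "(1 - b \<bullet> w) / (c \<bullet> w) \<in> J i" using i(2) by blast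
        moreover from this have "(b + ((1 - b \<bullet> w) / (c \<bullet> w)) *\<^sub>R c) \<bullet> w \<le> 0"
          using w unfolding J_def by blast
        ultimately show False by linarith
      qed
    qed
    then have "interior (K i) \<subseteq> interior {w. c \<bullet> w = 0}" by (rule interior_mono)
    then show False using int[OF i(1)] interior_hyperplane[OF c, of 0] by blast
  qed
  then obtain i j t where "i \<in> V" "j \<in> V" "t \<in> J i" "t \<in> J j" "\<not> K i \<subseteq> K j" "\<not> K j \<subseteq> K i" by blast
  then show ?thesis using that[of i j t] by (auto simp: J_def)
qed

text \<open>\<open>X\<close> and \<open>Y\<close> are scaled to the same level of \<open>a\<close>,
  so \<open>a\<close> vanishes on \<open>X - Y\<close>. Both cones meet that hyperplane only inside
  \<open>span {u}\<close>, so it suffices to push \<open>X - Y\<close> out of this span by moving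
  \<open>X\<close> along some \<open>e\<close> orthogonal to \<open>a\<close> and
  \<open>u\<close>.\<close>

lemma separating_directions_exist:
  fixes K L :: "'a::euclidean_space set"
  assumes dim: "DIM('a) \<ge> 3"
    and K: "conic K" "closed K" "K \<subseteq> closure (interior K)"
    and L: "conic L" "closed L" "L \<subseteq> closure (interior L)"
    and nonnested: "\<not> K \<subseteq> L" "\<not> L \<subseteq> K"
    and a: "a \<noteq> 0" "\<And>w. w \<in> K \<union> L \<Longrightarrow> a \<bullet> w \<le> 0"
    and u: "\<And>w. w \<in> K \<union> L \<Longrightarrow> a \<bullet> w = 0 \<Longrightarrow> w \<in> span {u}"
  obtains X Y where "X \<in> interior K" "X \<notin> L" "Y \<in> interior L" "Y \<notin> K"
    "X - Y \<notin> K \<union> L" "Y - X \<notin> K \<union> L"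
proof -
  have norm_point: "\<exists>x\<in>interior M - N. a \<bullet> x = -1"
    if M: "conic M" "M \<subseteq> closure (interior M)" "\<not> M \<subseteq> N" "\<And>w. w \<in> M \<Longrightarrow> a \<bullet> w \<le> 0"
      and N: "conic N" "closed N" for M N
  proof -
    have "open (- N)" using N(2) by (rule open_Compl)
    moreover have "- N \<inter> closure (interior M) \<noteq> {}" using M(2,3) by blast
    ultimately have "- N \<inter> interior M \<noteq> {}" using open_Int_closure_eq_empty by blast
    then obtain x where x: "x \<in> interior M" "x \<notin> N" by blast
    have "interior M \<subseteq> interior {w. a \<bullet> w \<le> 0}" using M(4) by (intro interior_mono) blast
    then have neg: "a \<bullet> x < 0" using x(1) interior_halfspace_le[OF a(1), of 0] by blast
    define \<sigma> where "\<sigma> = 1 / - (a \<bullet> x)"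
    have \<sigma>: "0 < \<sigma>" using neg by (simp add: \<sigma>_def)
    have "\<sigma> *\<^sub>R x \<in> interior M - N"
      using x conic_scaleR_mem_interior_iff[OF M(1) \<sigma>] conic_scaleR_mem_iff[OF N(1) \<sigma>] by blast
    moreover have "a \<bullet> (\<sigma> *\<^sub>R x) = -1" using neg by (simp add: \<sigma>_def)
    ultimately show ?thesis by blast
  qed
  have "\<And>w. w \<in> K \<Longrightarrow> a \<bullet> w \<le> 0" "\<And>w. w \<in> L \<Longrightarrow> a \<bullet> w \<le> 0" using a(2) by blast+
  then obtain X0 Y where X0: "X0 \<in> interior K - L" "a \<bullet> X0 = -1" and Y: "Y \<in> interior L - K" "a \<bullet> Y = -1"
    using norm_point[OF K(1,3) nonnested(1) _ L(1,2)] norm_point[OF L(1,3) nonnested(2) _ K(1,2)] by metis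
  obtain X where X: "X \<in> interior K - L" "a \<bullet> X = -1" "X - Y \<notin> span {u}"
  proof (cases "X0 - Y \<in> span {u}")
    case True
    obtain e where e: "e \<noteq> 0" "e \<bullet> a = 0" "e \<bullet> u = 0" using orthogonal_pair_exists[OF dim] by metis
    have "e \<notin> span {u}" using e(1,3) by (auto simp: span_singleton)
    have "open (interior K - L)" using L(2) by auto
    then obtain d where d: "0 < d" "ball X0 d \<subseteq> interior K - L" using X0(1) open_contains_ball by blast
    define \<delta> where "\<delta> = d / (2 * norm e)"
    have \<delta>: "\<delta> \<noteq> 0" "dist X0 (X0 + \<delta> *\<^sub>R e) < d" using d(1) e(1) by (auto simp: \<delta>_def dist_norm)
    have "X0 + \<delta> *\<^sub>R e - Y \<notin> span {u}"
    proof
      assume "X0 + \<delta> *\<^sub>R e - Y \<in> span {u}"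
      then have "(X0 + \<delta> *\<^sub>R e - Y) - (X0 - Y) \<in> span {u}" using True by (rule span_diff)
      then have "\<delta> *\<^sub>R e \<in> span {u}" by simp
      then have "(1/\<delta>) *\<^sub>R (\<delta> *\<^sub>R e) \<in> span {u}" by (rule span_scale)
      then show False using \<delta>(1) \<open>e \<notin> span {u}\<close> by simp
    qed
    moreover have "a \<bullet> (X0 + \<delta> *\<^sub>R e) = -1" using X0(2) e(2) by (simp add: inner_add_right inner_commute)
    moreover have "X0 + \<delta> *\<^sub>R e \<in> interior K - L" using d(2) \<delta>(2) by (meson mem_ball subsetD)
    ultimately show ?thesis using that by blast
  qed (use X0 that in blast)
  have "- (X - Y) \<notin> span {u}" using X(3) span_neg by fastforce
  moreover have "a \<bullet> (X - Y) = 0" "a \<bullet> - (X - Y) = 0" using X(2) Y(2) by (simp_all add: inner_diff_right)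
  ultimately have "X - Y \<notin> K \<union> L" "Y - X \<notin> K \<union> L"
    using X(3) u[of "X - Y"] u[of "- (X - Y)"] by (auto simp: inner_diff_right)
  then show ?thesis using that[of X Y] X(1) Y(1) by blast
qed

text \<open>The supporting functional \<open>a\<close> vanishes on the local cone only along those edge directions
  of the pieces containing \<open>c\<close> that are orthogonal to \<open>a\<close>.\<close>

lemma local_cone_face_subset_span:
  fixes P :: "'a::euclidean_space set"
  assumes F: "finite F" "P = \<Union>F" "\<And>S. S \<in> F \<Longrightarrow> finite (E S) \<and> S = convex hull (E S)"
    and K: "local_cone P c K r" and a: "\<And>w. w \<in> K \<Longrightarrow> a \<bullet> w \<le> 0"
    and u: "\<And>S v. S \<in> F \<Longrightarrow> v \<in> E S \<Longrightarrow> a \<bullet> (v - c) = 0 \<Longrightarrow> v - c \<in> span {u}"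
    and w: "w \<in> K" "a \<bullet> w = 0"
  shows "w \<in> span {u}"
proof -
  \<comment> \<open>The ball is shrunk to miss the pieces not containing \<open>c\<close>, so that
    the piece chosen below contains both \<open>c\<close> and
    \<open>c + s *\<^sub>R w\<close>.\<close>
  have "closed S" if "S \<in> F" for S
    using F(3)[OF that] compact_convex_hull finite_imp_compact compact_imp_closed by metis
  then have "closed (\<Union>{S\<in>F. c \<notin> S})" using F(1) by (intro closed_Union) auto
  then have "open (- \<Union>{S\<in>F. c \<notin> S})" by (rule open_Compl)
  moreover have "c \<in> - \<Union>{S\<in>F. c \<notin> S}" by blast
  ultimately obtain r' where r': "0 < r'" "ball c r' \<subseteq> - \<Union>{S\<in>F. c \<notin> S}"
    using open_contains_ball by blast
  have K': "local_cone P c K (min r r')" using K r'(1) by (auto simp: local_cone_def)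
  obtain s where s: "0 < s" "norm (s *\<^sub>R w) < min r r'" "c + s *\<^sub>R w \<in> P"
    using local_cone_shrink[OF K' w(1)] by metis
  then obtain S where S: "S \<in> F" "c + s *\<^sub>R w \<in> S" using F(2) by blast
  have "c + s *\<^sub>R w \<in> ball c r'" using s(2) by (simp add: dist_norm)
  then have "c \<in> S" using S r'(2) by blast
  note E = F(3)[OF S(1)]
  have "convex S" using E convex_convex_hull by metis
  \<comment> \<open>The segment from \<open>c\<close> to \<open>v\<close> stays in the convex piece
    \<open>S\<close>, so \<open>v - c\<close> points into the cone, where \<open>a\<close> is
    nonpositive.\<close>
  have le: "a \<bullet> v \<le> a \<bullet> c" if v: "v \<in> E S" for v
  proof -
    define d where "d = norm (v - c) + 1"
    define t where "t = min 1 (r / (2 * d))"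
    have "0 < r" using K by (simp add: local_cone_def)
    have d: "0 < d" "norm (v - c) \<le> d" using norm_ge_zero[of "v - c"] unfolding d_def by linarith+
    have t: "0 < t" "t \<le> 1" "t \<le> r / (2 * d)" using \<open>0 < r\<close> d(1) by (simp_all add: t_def)
    have "t * norm (v - c) \<le> r / (2 * d) * d"
      using t d \<open>0 < r\<close> by (intro mult_mono) auto
    also have "\<dots> = r / 2" using d(1) by simp
    finally have "t * norm (v - c) < r" using \<open>0 < r\<close> by simp
    then have "norm (t *\<^sub>R (v - c)) < r" using t(1) by simp
    moreover have "v \<in> S" using E v hull_inc by metis
    then have "c + t *\<^sub>R (v - c) \<in> S"
      using convexD_alt[OF \<open>convex S\<close> \<open>c \<in> S\<close>, of v t] t by (simp add: algebra_simps)
    then have "c + t *\<^sub>R (v - c) \<in> P" using S(1) F(2) by blast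
    ultimately have "t *\<^sub>R (v - c) \<in> K" using K by (simp add: local_cone_def)
    then have "a \<bullet> (t *\<^sub>R (v - c)) \<le> 0" by (rule a)
    then show ?thesis using t(1) by (simp add: mult_le_0_iff inner_diff_right)
  qed
  \<comment> \<open>This point maximises \<open>a\<close> over the piece, hence is a convex
    combination of generators at the same level as \<open>c\<close>.\<close>
  have "c + s *\<^sub>R w \<in> convex hull {v \<in> E S. a \<bullet> v = a \<bullet> c}"
    using E S(2) le w(2) by (intro convex_hull_face_subset) (auto simp: inner_add_right)
  also have "\<dots> \<subseteq> (+) c ` span {u}"
  proof (rule hull_minimal)
    show "convex ((+) c ` span {u})" by (intro convex_translation subspace_imp_convex) simp
    show "{v \<in> E S. a \<bullet> v = a \<bullet> c} \<subseteq> (+) c ` span {u}"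
      using u[OF S(1)] by (auto simp: translate_mem_iff inner_diff_right)
  qed
  finally have "s *\<^sub>R w \<in> span {u}" by (simp add: translate_mem_iff)
  then have "(1/s) *\<^sub>R (s *\<^sub>R w) \<in> span {u}" by (rule span_scale)
  then show ?thesis using s(1) by simp
qed

text \<open>The generators of the pieces act as the vertices of the possibly nonconvex
  \<open>P\<close>; they need not all be extreme points.\<close>

lemma convex_hulls_vertices:
  assumes F: "finite F" "P = \<Union>F" and E: "\<And>S. S \<in> F \<Longrightarrow> finite (E S) \<and> S = convex hull (E S)"
    and V: "V = (\<Union>S\<in>F. E S)"
  shows "finite V" "V \<subseteq> P" "P \<subseteq> convex hull V"
proof -
  show "finite V" using F(1) E by (auto simp: V)
  show "P \<subseteq> convex hull V"
  proof
    fix x assume "x \<in> P"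
    then obtain S where S: "S \<in> F" "x \<in> convex hull E S" using F(2) E by blast
    have "E S \<subseteq> V" using S(1) by (auto simp: V)
    then show "x \<in> convex hull V" using S(2) hull_mono by blast
  qed
  show "V \<subseteq> P"
  proof
    fix v assume "v \<in> V"
    then obtain S where S: "S \<in> F" "v \<in> E S" by (auto simp: V)
    then have "v \<in> convex hull E S" by (simp add: hull_inc)
    then show "v \<in> P" using E[OF S(1)] F(2) S(1) by auto
  qed
qed

text \<open>Each functional on a generic line is maximal over \<open>P\<close> at some element of
  \<open>V\<close> and so supports the cone there. Genericity with respect to differences of
  elements of \<open>V\<close> leaves at most one edge direction, up to scaling, orthogonal to
  it.\<close>

lemma supported_local_cones_exist:
  fixes P :: "'a::euclidean_space set"
  assumes dim: "DIM('a) \<ge> 2" and F: "finite F" "P = \<Union>F"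
    and E: "\<And>S. S \<in> F \<Longrightarrow> finite (E S) \<and> S = convex hull (E S)"
    and P: "P \<noteq> {}" "P = closure (interior P)"
    and K: "\<And>c. local_cone P c (K c) (r c)"
  obtains a u c1 c2 where "a \<noteq> 0" "\<And>w. w \<in> K c1 \<union> K c2 \<Longrightarrow> a \<bullet> w \<le> 0"
    "\<And>w. w \<in> K c1 \<union> K c2 \<Longrightarrow> a \<bullet> w = 0 \<Longrightarrow> w \<in> span {u}"
    "\<not> K c1 \<subseteq> K c2" "\<not> K c2 \<subseteq> K c1"
proof -
  define V where "V = (\<Union>S\<in>F. E S)"
  note finV = convex_hulls_vertices(1)[OF F E V_def] and VP = convex_hulls_vertices(2)[OF F E V_def]
    and PV = convex_hulls_vertices(3)[OF F E V_def]
  have EV: "E S \<subseteq> V" if "S \<in> F" for S using that by (auto simp: V_def)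
  have "V \<noteq> {}" using PV P(1) by auto
  define G where "G = (\<lambda>(v, w). v - w) ` (V \<times> V) - {0}"
  have "finite G" "0 \<notin> G" using finV by (auto simp: G_def)
  then obtain b c :: 'a where bc: "c \<noteq> 0" "\<And>t. b + t *\<^sub>R c \<noteq> 0"
    "\<And>t. \<exists>u. \<forall>g\<in>G. (b + t *\<^sub>R c) \<bullet> g = 0 \<longrightarrow> g \<in> span {u}"
    using generic_line_exists[OF _ _ dim, of G] by metis
  have cov: "\<exists>v\<in>V. \<forall>w\<in>K v. (b + t *\<^sub>R c) \<bullet> w \<le> 0" for t
  proof -
    define a where "a = b + t *\<^sub>R c"
    have "Max ((\<bullet>) a ` V) \<in> (\<bullet>) a ` V" using finV \<open>V \<noteq> {}\<close> by (intro Max_in) auto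
    then obtain v where v: "v \<in> V" "a \<bullet> v = Max ((\<bullet>) a ` V)" by auto
    then have "V \<subseteq> {x. a \<bullet> x \<le> a \<bullet> v}" using finV by auto
    then have "convex hull V \<subseteq> {x. a \<bullet> x \<le> a \<bullet> v}" by (intro hull_minimal convex_halfspace_le)
    then have le: "P \<subseteq> {x. a \<bullet> x \<le> a \<bullet> v}" using PV by (rule subset_trans[rotated])
    have "a \<bullet> w \<le> 0" if w: "w \<in> K v" for w
    proof -
      obtain s where s: "0 < s" "v + s *\<^sub>R w \<in> P" using local_cone_shrink[OF K w] by metis
      then have "a \<bullet> (v + s *\<^sub>R w) \<le> a \<bullet> v" using le by blast
      then show ?thesis using s(1) by (simp add: inner_add_right mult_le_0_iff)
    qed
    then show ?thesis using v(1) unfolding a_def by blast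
  qed
  have int: "interior (K v) \<noteq> {}" if "v \<in> V" for v
  proof -
    have "v + 0 \<in> P" using that VP by auto
    then have "0 \<in> K v" using K[of v] unfolding local_cone_def by (metis norm_zero)
    then show ?thesis using local_cone_subset_closure_interior[OF K P(2), of v] by force
  qed
  obtain t c1 c2 where t: "c1 \<in> V" "c2 \<in> V"
    "\<And>w. w \<in> K c1 \<union> K c2 \<Longrightarrow> (b + t *\<^sub>R c) \<bullet> w \<le> 0" "\<not> K c1 \<subseteq> K c2" "\<not> K c2 \<subseteq> K c1"
    using nonnested_pair_exists[OF finV cov int bc(1)] by metis
  obtain u where u: "\<And>g. g \<in> G \<Longrightarrow> (b + t *\<^sub>R c) \<bullet> g = 0 \<Longrightarrow> g \<in> span {u}" using bc(3)[of t] by blast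
  have face: "w \<in> span {u}" if "v \<in> V" "\<And>w. w \<in> K v \<Longrightarrow> (b + t *\<^sub>R c) \<bullet> w \<le> 0" "w \<in> K v" "(b + t *\<^sub>R c) \<bullet> w = 0" for v w
  proof (rule local_cone_face_subset_span[OF F E K[of v] that(2) _ that(3,4)])
    fix S x assume S: "S \<in> F" "x \<in> E S" and 0: "(b + t *\<^sub>R c) \<bullet> (x - v) = 0"
    have "x - v = 0 \<or> x - v \<in> G" using S EV that(1) by (force simp: G_def)
    then show "x - v \<in> span {u}" using u[OF _ 0] span_zero by metis
  qed
  show ?thesis
    by (rule that[OF bc(2) t(3) _ t(4,5)]) (use face t(1-3) in auto)
qed

section \<open>Avoiding the configuration\<close>

text \<open>The points are projected orthogonally onto the hyperplane with normal \<open>b\<close>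
  through a fixed point \<open>x0\<close> of the old one. For \<open>b = b0\<close> nothing moves,
  so for \<open>b\<close> near \<open>b0\<close> they stay in the sets \<open>U p\<close>.\<close>

lemma perturb_into_generic_hyperplane:
  fixes F G :: "'a::euclidean_space set"
  assumes F: "finite F" and G: "finite G" "0 \<notin> G" and b0: "b0 \<noteq> 0" "\<And>p. p \<in> F \<Longrightarrow> b0 \<bullet> p = \<beta>"
    and U: "\<And>p. p \<in> F \<Longrightarrow> open (U p) \<and> p \<in> U p"
  obtains b f m where "\<And>g. g \<in> G \<Longrightarrow> b \<bullet> g \<noteq> 0"
    "\<And>p. p \<in> F \<Longrightarrow> f p \<in> U p" "\<And>p. p \<in> F \<Longrightarrow> b \<bullet> f p = m"
proof -
  define x0 where "x0 = (\<beta> / (b0 \<bullet> b0)) *\<^sub>R b0"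
  have x0: "b0 \<bullet> x0 = \<beta>" using b0(1) by (simp add: x0_def)
  define f where "f b p = p - (b \<bullet> (p - x0) / (b \<bullet> b)) *\<^sub>R b" for b p
  have "\<forall>\<^sub>F b in nhds b0. f b p \<in> U p" if "p \<in> F" for p
  proof -
    have "((\<lambda>b. f b p) \<longlongrightarrow> p - (b0 \<bullet> (p - x0) / (b0 \<bullet> b0)) *\<^sub>R b0) (nhds b0)"
      unfolding f_def using b0(1) by (intro tendsto_intros filterlim_ident) auto
    then have "((\<lambda>b. f b p) \<longlongrightarrow> p) (nhds b0)" using b0(2)[OF that] x0 by (simp add: inner_diff_right)
    then show ?thesis using U[OF that] topological_tendstoD by blast
  qed
  then have "\<forall>\<^sub>F b in nhds b0. \<forall>p\<in>F. f b p \<in> U p" using F by (simp add: eventually_ball_finite)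
  then obtain W where W: "open W" "b0 \<in> W" "\<And>b p. b \<in> W \<Longrightarrow> p \<in> F \<Longrightarrow> f b p \<in> U p"
    unfolding eventually_nhds by blast
  have "open (W - {0})" "W - {0} \<noteq> {}" using W(1,2) b0(1) by auto
  then obtain b where b: "b \<in> W - {0}" "\<And>g. g \<in> G \<Longrightarrow> b \<bullet> g \<noteq> 0"
    using generic_vector_exists[OF G] by blast
  have "b \<bullet> f b p = b \<bullet> x0" for p
    using b(1) by (simp add: f_def inner_diff_right)
  then show ?thesis using that[of b "f b" "b \<bullet> x0"] b W(3) by blast
qed

text \<open>By genericity \<open>b\<close> is maximal on \<open>P\<close> at a single point
  \<open>v\<close>. The translate with \<open>v\<close> placed at \<open>x\<close> reaches the level
  of \<open>x\<close> only at \<open>x\<close>, so it misses \<open>F\<close>. As \<open>v\<close>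
  is a limit of interior points, a slight shift puts \<open>x\<close> into the interior and still
  misses \<open>F\<close>.\<close>

lemma missing_translate_exists_aux:
  fixes P :: "'a::euclidean_space set"
  assumes V: "finite V" "V \<noteq> {}" "V \<subseteq> P" "P \<subseteq> convex hull V" and P: "P = closure (interior P)"
    and b: "\<And>v w. v \<in> V \<Longrightarrow> w \<in> V \<Longrightarrow> v \<noteq> w \<Longrightarrow> b \<bullet> v \<noteq> b \<bullet> w"
    and F: "finite F" "\<And>y. y \<in> F \<Longrightarrow> b \<bullet> x \<le> b \<bullet> y" "x \<notin> F"
  shows "\<exists>t. x - t \<in> interior P \<and> (\<forall>y\<in>F. y - t \<notin> P)"
proof -
  have "Max ((\<bullet>) b ` V) \<in> (\<bullet>) b ` V" using V(1,2) by (intro Max_in) auto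
  then obtain v where v: "v \<in> V" "b \<bullet> v = Max ((\<bullet>) b ` V)" by auto
  then have max: "b \<bullet> w \<le> b \<bullet> v" if "w \<in> V" for w using V(1) that by simp
  have "convex hull V \<subseteq> {x. b \<bullet> x \<le> b \<bullet> v}"
    using max by (intro hull_minimal convex_halfspace_le) blast
  then have le: "b \<bullet> p \<le> b \<bullet> v" if "p \<in> P" for p using V(4) that by blast
  have "{w \<in> V. b \<bullet> w = b \<bullet> v} = {v}" using v(1) b by blast
  then have unique: "p = v" if "p \<in> P" "b \<bullet> p = b \<bullet> v" for p
    using convex_hull_face_subset[OF V(1) subsetD[OF V(4) that(1)] max that(2)] by simp
  have "closed P" using P closed_closure by metis
  have out: "y - x + v \<notin> P" if "y \<in> F" for y
  proof
    assume "y - x + v \<in> P"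
    moreover from this have "b \<bullet> (y - x + v) = b \<bullet> v"
      using le[of "y - x + v"] F(2)[OF that] by (simp add: inner_add_right inner_diff_right)
    ultimately have "y - x + v = v" by (rule unique)
    then show False using F(3) that by simp
  qed
  define W where "W = (\<Inter>y\<in>F. (\<lambda>c. y - x + c) -` (- P))"
  have "open W" unfolding W_def
    using F(1) \<open>closed P\<close> by (intro open_INT ballI open_vimage open_Compl continuous_intros) auto
  moreover have "v \<in> W \<inter> closure (interior P)" using out V(3) v(1) P by (auto simp: W_def)
  ultimately have "W \<inter> interior P \<noteq> {}" using open_Int_closure_eq_empty by blast
  then obtain c where "c \<in> interior P" "\<forall>y\<in>F. y - x + c \<notin> P" by (auto simp: W_def)
  then show ?thesis by (intro exI[of _ "x - c"]) (simp add: algebra_simps)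
qed

lemma missing_translate_exists:
  fixes P :: "'a::euclidean_space set"
  assumes V: "finite V" "V \<noteq> {}" "V \<subseteq> P" "P \<subseteq> convex hull V" and P: "P = closure (interior P)"
    and b: "\<And>v w. v \<in> V \<Longrightarrow> w \<in> V \<Longrightarrow> v \<noteq> w \<Longrightarrow> b \<bullet> v \<noteq> b \<bullet> w"
    and F: "finite F" "\<And>y. y \<in> F \<Longrightarrow> b \<bullet> y = m" "x \<notin> F"
  shows "\<exists>t. x - t \<in> interior P \<and> (\<forall>y\<in>F. y - t \<notin> P)"
proof (cases "b \<bullet> x \<le> m")
  case True
  then show ?thesis using F by (intro missing_translate_exists_aux[OF V P b]) auto
next
  case False
  \<comment> \<open>Beyond the hyperplane the opposite functional is used, which selects the minimum
    of \<open>b\<close> on \<open>P\<close>.\<close>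
  then show ?thesis using F b by (intro missing_translate_exists_aux[OF V P, of "- b"]) auto
qed

section \<open>Indecomposability of polytopes\<close>

text \<open>Covers the closed solid and its interior at once: the configuration only uses points
  interior to a translate of \<open>P\<close> or outside it, so boundary points of \<open>C\<close>
  do not matter.\<close>

lemma not_cover_decomposable_closed_solid:
  fixes P C :: "'a::euclidean_space set"
  assumes dim: "DIM('a) \<ge> 3" and P: "polyhedral_set P" "P = closure (interior P)" "bounded P" "P \<noteq> {}"
    and C: "interior P \<subseteq> C" "C \<subseteq> P"
  shows "\<not> cover_decomposable C"
proof (rule not_cover_decomposable_if_configurations)
  fix m
  obtain F where F: "finite F" "P = \<Union>F" "\<And>S. S \<in> F \<Longrightarrow> polyhedron S"
    using P(1) unfolding polyhedral_set_def by blast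
  have "\<exists>W. finite W \<and> S = convex hull W" if "S \<in> F" for S
  proof -
    have "bounded S" using P(3) F(2) that bounded_subset by blast
    then show ?thesis
      using F(3)[OF that] polytope_eq_bounded_polyhedron unfolding polytope_def by blast
  qed
  then obtain E where E: "\<And>S. S \<in> F \<Longrightarrow> finite (E S) \<and> S = convex hull (E S)" by metis
  define V where "V = (\<Union>S\<in>F. E S)"
  note V = convex_hulls_vertices(1)[OF F(1,2) E V_def] and VP = convex_hulls_vertices(2)[OF F(1,2) E V_def]
    and PV = convex_hulls_vertices(3)[OF F(1,2) E V_def]
  have "V \<noteq> {}" using PV P(4) by auto
  obtain K r where K: "\<And>c. local_cone P c (K c) (r c)"
    using local_cone_polyhedral_set[OF F(1,3)] F(2) by metis
  then have Kc: "\<And>c. conic (K c)" "\<And>c. closed (K c)" "\<And>c. 0 < r c" by (auto simp: local_cone_def)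
  note cl = local_cone_subset_closure_interior[OF K P(2)]
  have "DIM('a) \<ge> 2" using dim by simp
  from supported_local_cones_exist[OF this F(1,2) E P(4,2) K]
  obtain a u c1 c2 where a: "a \<noteq> 0" "\<And>w. w \<in> K c1 \<union> K c2 \<Longrightarrow> a \<bullet> w \<le> 0"
    "\<And>w. w \<in> K c1 \<union> K c2 \<Longrightarrow> a \<bullet> w = 0 \<Longrightarrow> w \<in> span {u}"
    "\<not> K c1 \<subseteq> K c2" "\<not> K c2 \<subseteq> K c1" by metis
  obtain X Y where XY: "X \<in> interior (K c1)" "X \<notin> K c2" "Y \<in> interior (K c2)" "Y \<notin> K c1"
    "X - Y \<notin> K c1 \<union> K c2" "Y - X \<notin> K c1 \<union> K c2"
    by (rule separating_directions_exist[OF dim Kc(1,2) cl Kc(1,2) cl a(4,5,1,2,3)])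
  define \<rho> where "\<rho> = min (r c1) (r c2) / 2"
  have "0 < \<rho>" using Kc(3) by (simp add: \<rho>_def)
  obtain S Q1 Q2 where conf: "tree_conf (K c1) (K c2) (X - Y) m m S Q1 Q2" "S \<union> Q1 \<union> Q2 \<subseteq> ball 0 \<rho>"
    using tree_conf_exists[OF Kc(1,2) Kc(1,2) XY \<open>0 < \<rho>\<close>] by metis
  have small: "norm (q - s) < r c1" "norm (q - s) < r c2" if "q \<in> Q1 \<union> Q2" "s \<in> S" for q s
  proof -
    have "norm q < \<rho>" "norm s < \<rho>" using conf(2) that by auto
    then show "norm (q - s) < r c1" "norm (q - s) < r c2"
      using norm_triangle_ineq4[of q s] unfolding \<rho>_def by linarith+
  qed
  have mem: "c1 + q - s \<in> P \<longleftrightarrow> q - s \<in> K c1" "c2 + q - s \<in> P \<longleftrightarrow> q - s \<in> K c2"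
    if "q \<in> Q1 \<union> Q2" "s \<in> S" for q s
    using small[OF that] K[of c1] K[of c2] unfolding local_cone_def by (simp_all add: add_diff_eq[symmetric])
  have memi: "c1 + q - s \<in> interior P \<longleftrightarrow> q - s \<in> interior (K c1)" "c2 + q - s \<in> interior P \<longleftrightarrow> q - s \<in> interior (K c2)"
    if "q \<in> Q1 \<union> Q2" "s \<in> S" for q s
    using local_cone_interior[OF K small(1)[OF that]] local_cone_interior[OF K small(2)[OF that]]
    by (simp_all add: add_diff_eq)
  \<comment> \<open>The two kinds of edge points are moved to \<open>c1\<close> and
    \<open>c2\<close>, while the same translates \<open>S\<close> serve both; near each centre
    \<open>P\<close> looks like the corresponding cone.\<close>
  define T where "T = (+) c1 ` Q1 \<union> (+) c2 ` Q2"
  have fin: "finite S" "finite Q1" "finite Q2" using conf(1) by (simp_all add: tree_conf_def)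
  then have "finite T" by (simp add: T_def)
  have TI: "p - s \<in> interior P" if p: "p \<in> T" "s \<in> S" "p - s \<in> P" for p s
    using p(1) unfolding T_def
  proof
    assume "p \<in> (+) c1 ` Q1"
    then obtain q where q: "q \<in> Q1" "p = c1 + q" by blast
    then have "q - s \<in> K c1" using mem(1)[of q s] p by simp
    then have "q - s \<in> interior (K c1)" using conf(1) q(1) p(2) unfolding tree_conf_def by blast
    then show ?thesis using memi(1)[of q s] q p(2) by simp
  next
    assume "p \<in> (+) c2 ` Q2"
    then obtain q where q: "q \<in> Q2" "p = c2 + q" by blast
    then have "q - s \<in> K c2" using mem(2)[of q s] p by simp
    then have "q - s \<in> interior (K c2)" using conf(1) q(1) p(2) unfolding tree_conf_def by blast
    then show ?thesis using memi(2)[of q s] q p(2) by simp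
  qed
  have deg: "m \<le> card {s\<in>S. p - s \<in> P}" if "p \<in> T" for p
    using that unfolding T_def
  proof
    assume "p \<in> (+) c1 ` Q1"
    then obtain q where q: "q \<in> Q1" "p = c1 + q" by blast
    then have "{s\<in>S. p - s \<in> P} = {s\<in>S. q - s \<in> K c1}" using mem(1)[of q] by auto
    then show ?thesis using conf(1) q(1) by (simp add: tree_conf_def)
  next
    assume "p \<in> (+) c2 ` Q2"
    then obtain q where q: "q \<in> Q2" "p = c2 + q" by blast
    then have "{s\<in>S. p - s \<in> P} = {s\<in>S. q - s \<in> K c2}" using mem(2)[of q] by auto
    then show ?thesis using conf(1) q(1) by (simp add: tree_conf_def)
  qed
  have col: "\<exists>p\<in>T. {s\<in>S. p - s \<in> P} \<subseteq> R \<or> {s\<in>S. p - s \<in> P} \<inter> R = {}" for R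
  proof -
    have "(\<exists>q\<in>Q1. {s\<in>S. q - s \<in> K c1} \<subseteq> R) \<or> (\<exists>q\<in>Q2. {s\<in>S. q - s \<in> K c2} \<inter> R = {})"
      using conf(1) unfolding tree_conf_def by blast
    then show ?thesis
    proof (elim disjE bexE)
      fix q assume q: "q \<in> Q1" "{s\<in>S. q - s \<in> K c1} \<subseteq> R"
      then have "{s\<in>S. (c1 + q) - s \<in> P} \<subseteq> R" using mem(1)[of q] by auto
      then show ?thesis using q(1) unfolding T_def by (intro bexI[of _ "c1 + q"]) auto
    next
      fix q assume q: "q \<in> Q2" "{s\<in>S. q - s \<in> K c2} \<inter> R = {}"
      then have "{s\<in>S. (c2 + q) - s \<in> P} \<inter> R = {}" using mem(2)[of q] by auto
      then show ?thesis using q(1) unfolding T_def by (intro bexI[of _ "c2 + q"]) auto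
    qed
  qed
  \<comment> \<open>Orthogonal to the line carrying the edge points and to \<open>c1 - c2\<close>,
    \<open>b0\<close> is constant on \<open>T\<close>.\<close>
  obtain b0 where b0: "b0 \<noteq> 0" "b0 \<bullet> (X - Y) = 0" "b0 \<bullet> (c1 - c2) = 0"
    using orthogonal_pair_exists[OF dim] by metis
  have "b0 \<bullet> q = 0" if q: "q \<in> Q1 \<union> Q2" for q
  proof -
    obtain \<mu> where "q = \<mu> *\<^sub>R (X - Y)" using conf(1) q unfolding tree_conf_def by blast
    then show ?thesis using b0(2) by (simp only: inner_scaleR_right)
  qed
  then have plane: "b0 \<bullet> p = b0 \<bullet> c1" if "p \<in> T" for p
    using that b0(3) unfolding T_def by (auto simp: inner_add_right inner_diff_right)
  \<comment> \<open>Moving \<open>p\<close> within \<open>U p\<close> keeps it interior to the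
    translates containing it and outside the others, so its edge is unchanged.\<close>
  define U where "U p = (\<Inter>s\<in>S. (\<lambda>y. y - s) -` (if p - s \<in> P then interior P else - P))" for p
  have "closed P" using P(2) closed_closure by metis
  then have U: "open (U p) \<and> p \<in> U p" if "p \<in> T" for p
    using TI[OF that] fin(1) unfolding U_def
    by (intro conjI open_INT ballI open_vimage continuous_intros) auto
  define G where "G = (\<lambda>(v, w). v - w) ` (V \<times> V) - {0}"
  have G: "finite G" "0 \<notin> G" using V by (auto simp: G_def)
  obtain b f k where b: "\<And>g. g \<in> G \<Longrightarrow> b \<bullet> g \<noteq> 0"
    and f: "\<And>p. p \<in> T \<Longrightarrow> f p \<in> U p" "\<And>p. p \<in> T \<Longrightarrow> b \<bullet> f p = k"
    using perturb_into_generic_hyperplane[OF \<open>finite T\<close> G b0(1) plane U] by metis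
  have fC: "f p - s \<in> C \<longleftrightarrow> p - s \<in> P" if "p \<in> T" "s \<in> S" for p s
  proof -
    have "f p - s \<in> (if p - s \<in> P then interior P else - P)"
      using f(1)[OF that(1)] that(2) unfolding U_def by blast
    then show ?thesis using C by (auto split: if_splits)
  qed
  then have edge: "{s\<in>S. f p - s \<in> C} = {s\<in>S. p - s \<in> P}" if "p \<in> T" for p using that by blast
  have bV: "b \<bullet> v \<noteq> b \<bullet> w" if "v \<in> V" "w \<in> V" "v \<noteq> w" for v w
  proof -
    have "v - w \<in> G" using that by (force simp: G_def)
    then have "b \<bullet> (v - w) \<noteq> 0" by (rule b)
    then show ?thesis by (simp add: inner_diff_right)
  qed
  have iC: "interior P \<subseteq> interior C" using C(1) by (simp add: interior_maximal)
  have ext: "\<exists>t. x - t \<in> interior C \<and> (\<forall>p\<in>f ` T. p - t \<notin> C)" if "x \<notin> f ` T" for x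
  proof -
    have "\<exists>t. x - t \<in> interior P \<and> (\<forall>y\<in>f ` T. y - t \<notin> P)"
      using that f(2) \<open>finite T\<close>
      by (intro missing_translate_exists[OF V \<open>V \<noteq> {}\<close> VP PV P(2) bV]) auto
    then show ?thesis using iC C(2) by blast
  qed
  show "\<exists>S F. finite S \<and> finite F \<and>
      (\<forall>p\<in>F. m \<le> card {s\<in>S. p - s \<in> C}) \<and>
      (\<forall>R. \<exists>p\<in>F. {s\<in>S. p - s \<in> C} \<subseteq> R \<or> {s\<in>S. p - s \<in> C} \<inter> R = {}) \<and>
      (\<forall>x. x \<notin> F \<longrightarrow> (\<exists>t. x - t \<in> interior C \<and> (\<forall>p\<in>F. p - t \<notin> C)))"
  proof (rule exI[of _ S], rule exI[of _ "f ` T"], intro conjI allI impI)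
    show "\<forall>p\<in>f ` T. m \<le> card {s\<in>S. p - s \<in> C}" using deg edge by simp
    show "\<exists>p\<in>f ` T. {s\<in>S. p - s \<in> C} \<subseteq> R \<or> {s\<in>S. p - s \<in> C} \<inter> R = {}" for R
    proof -
      obtain p where p: "p \<in> T" "{s\<in>S. p - s \<in> P} \<subseteq> R \<or> {s\<in>S. p - s \<in> P} \<inter> R = {}"
        using col[of R] by blast
      show ?thesis by (rule bexI[of _ "f p"]) (use p edge[OF p(1)] in auto)
    qed
  qed (use fin \<open>finite T\<close> ext in auto)
qed

theorem theoremB:
  fixes C :: "(real ^ 'n) set"
  assumes "CARD('n) \<ge> 3"
    and "solid_polytope C"
  shows "\<not> cover_decomposable C"
proof -
  obtain P where P: "polyhedral_set P" "P = closure (interior P)" "C = P \<or> C = interior P"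
    and C: "bounded C" "C \<noteq> {}"
    using assms(2) unfolding solid_polytope_def by blast
  have sub: "interior P \<subseteq> C" "C \<subseteq> P" using P(3) interior_subset by auto
  have "bounded P" using P(2) C(1) sub(1) bounded_subset bounded_closure by metis
  moreover have "P \<noteq> {}" using sub C(2) by blast
  ultimately show ?thesis
    using not_cover_decomposable_closed_solid[OF _ P(1,2)] sub assms(1) by simp
qed

end
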